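(* Consider the equation $$\ddot x + \gamma \dot x + x^{2p+1} = f(\boldsymbol{\omega} t),$$ where $p\in\mathbb{N}$, $f$ is a quasi-periodic function, analytic in its argument, with non-zero average $f_{\boldsymbol 0}\neq 0$, and $\boldsymbol{\omega}\in\mathbb{R}^d$ satisfies the Diophantine condition $|\boldsymbol{\omega}\cdot\boldsymbol{\nu}|\ge C_0|\boldsymbol{\nu}|^{-\tau}$ for all $\boldsymbol{\nu}\in\mathbb{Z}^d\setminus\{\boldsymbol 0\}$. There exists $\gamma_0>0$ such that for all $\gamma>\gamma_0$ there is a quasi-periodic solution $x_0(t)$ with the same frequency vector $\boldsymbol{\omega}$ as the forcing term. Such a solution extends to a function analytic in $1/\gamma$ in a disc $\mathcal{D}$ of the complex plane tangent to the imaginary axis at the origin and centered on the real axis. Furthermore, $x_0(t)=\alpha+O(1/\gamma)$, where $\alpha=f_{\boldsymbol 0}^{1/(2p+1)}\neq 0$.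
   Context: $\gamma>0$ is a real parameter (dissipation coefficient). $f(\boldsymbol{\psi})=\sum_{\boldsymbol{\nu}\in\mathbb{Z}^d}e^{i\boldsymbol{\nu}\cdot\boldsymbol{\psi}}f_{\boldsymbol{\nu}}$ is real-valued and analytic: there are constants $F,\xi>0$ with $|f_{\boldsymbol{\nu}}|\le F e^{-\xi|\boldsymbol{\nu}|}$ for all $\boldsymbol{\nu}\in\mathbb{Z}^d$. Its average is $\langle f\rangle=f_{\boldsymbol 0}$. Here $|\boldsymbol{\nu}|=|\nu_1|+\dots+|\nu_d|$, $\cdot$ is the scalar product in $\mathbb{R}^d$, and $C_0>0$, $\tau>d-1$ are constants with $C_0$ small enough (for $d=1$ the Diophantine condition is automatically satisfied). A quasi-periodic solution with frequency vector $\boldsymbol{\omega}$ is a solution of the form $x_0(t)=X(\boldsymbol{\omega}t)$ with $X(\boldsymbol\psi)$ $2\pi$-periodic in each component of $\boldsymbol{\psi}\in\mathbb{R}^d$. $f_{\boldsymbol 0}^{1/(2p+1)}$ denotes the real odd root. *)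

theory Defs
  imports "HOL-Complex_Analysis.Complex_Analysis"
begin

definition real_of_int_vec :: "int ^ 'd \<Rightarrow> real ^ 'd::finite" where
  "real_of_int_vec \<nu> = (\<chi> i. real_of_int (\<nu> $ i))"

definition norm_l1 :: "int ^ 'd::finite \<Rightarrow> real" where
  "norm_l1 \<nu> = (\<Sum>i\<in>UNIV. real_of_int \<bar>\<nu> $ i\<bar>)"

definition diophantine :: "real \<Rightarrow> real \<Rightarrow> real ^ 'd::finite \<Rightarrow> bool" where
  "diophantine C0 \<tau> \<omega> \<longleftrightarrow>
     (\<forall>\<nu>. \<nu> \<noteq> 0 \<longrightarrow> \<bar>\<omega> \<bullet> real_of_int_vec \<nu>\<bar> \<ge> C0 * norm_l1 \<nu> powr (- \<tau>))"

(* The family c is indexed by the whole lattice and summed unconditionally. *)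
definition has_fourier_series ::
    "(real ^ 'd::finite \<Rightarrow> real) \<Rightarrow> (int ^ 'd \<Rightarrow> complex) \<Rightarrow> bool" where
  "has_fourier_series f c \<longleftrightarrow>
     (\<forall>\<psi>. ((\<lambda>\<nu>. exp (\<i> * complex_of_real (real_of_int_vec \<nu> \<bullet> \<psi>)) * c \<nu>)
             has_sum complex_of_real (f \<psi>)) UNIV)"

definition periodic_2pi :: "(real ^ 'd::finite \<Rightarrow> 'b) \<Rightarrow> bool" where
  "periodic_2pi X \<longleftrightarrow> (\<forall>\<psi> i. X (\<psi> + axis i (2 * pi)) = X \<psi>)"

(* Continuity of the hull X is essential: when the components of \<omega> are rationally
   independent, every function of time factors through some 2 pi-periodic X that need
   not be continuous. *)
definition quasi_periodic_hull ::
    "real ^ 'd::finite \<Rightarrow> (real ^ 'd \<Rightarrow> real) \<Rightarrow> (real \<Rightarrow> real) \<Rightarrow> bool" where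
  "quasi_periodic_hull \<omega> X x \<longleftrightarrow>
     continuous_on UNIV X \<and> periodic_2pi X \<and> (\<forall>t. x t = X (t *\<^sub>R \<omega>))"

definition solves_ode :: "nat \<Rightarrow> real \<Rightarrow> (real \<Rightarrow> real) \<Rightarrow> (real \<Rightarrow> real) \<Rightarrow> bool" where
  "solves_ode p \<gamma> g x \<longleftrightarrow>
     (\<exists>x' x''. (\<forall>t. (x has_real_derivative x' t) (at t)) \<and>
               (\<forall>t. (x' has_real_derivative x'' t) (at t)) \<and>
               (\<forall>t. x'' t + \<gamma> * x' t + x t ^ (2 * p + 1) = g t))"

definition tangent_disc :: "real \<Rightarrow> complex set" where
  "tangent_disc R = ball (complex_of_real R) R"

(* Z \<epsilon> \<psi> depends analytically on \<epsilon> in D as a family of continuous functions on the torus: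
   holomorphy at each \<psi> together with joint continuity. *)
definition analytic_torus_family ::
    "complex set \<Rightarrow> (complex \<Rightarrow> real ^ 'd::finite \<Rightarrow> complex) \<Rightarrow> bool" where
  "analytic_torus_family D Z \<longleftrightarrow>
     continuous_on (D \<times> UNIV) (\<lambda>(\<epsilon>, \<psi>). Z \<epsilon> \<psi>) \<and>
     (\<forall>\<epsilon>\<in>D. periodic_2pi (Z \<epsilon>)) \<and>
     (\<forall>\<psi>. (\<lambda>\<epsilon>. Z \<epsilon> \<psi>) holomorphic_on D)"

(* For a real-valued function the coefficient c 0 is real, so Re loses nothing. *)
definition odd_root_average :: "nat \<Rightarrow> (int ^ 'd::finite \<Rightarrow> complex) \<Rightarrow> real" where
  "odd_root_average p c = root (2 * p + 1) (Re (c 0))"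

end

theory Submission
  imports Defs
begin

text \<open>
  Put \<open>\<epsilon> = 1 / \<gamma>\<close>, \<open>g(x) = x\<^sup>2\<^sup>p\<^sup>+\<^sup>1\<close>, let \<open>\<alpha>\<close> be the real odd root of the average of \<open>f\<close>, so that
  \<open>g(\<alpha>)\<close> is that average, and put \<open>a = g'(\<alpha>) > 0\<close>. Let \<open>D\<close> be the derivative along \<open>\<omega>\<close> on the
  torus. A hull of a quasi-periodic solution is a function \<open>x\<close> on the torus with
  \<open>D\<^sup>2x + \<gamma> D x + g(x) = f\<close>. It is sought in the form \<open>x = \<alpha> + \<epsilon> y\<close>, \<open>y = w\<^sub>1 + \<epsilon> w\<^sub>2 + u\<close>.

  Two steps of averaging remove the small divisors from the problem. Let \<open>W\<^sub>k\<close> be the \<open>k\<close>-th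
  derivative of the oscillating part \<open>W\<^sub>0\<close> of \<open>f\<close> along the flow, where negative \<open>k\<close> denote
  primitives. The Diophantine condition makes division by a frequency cost only a power of
  \<open>|\<nu>|\<close>, which the exponential decay of the Fourier coefficients absorbs, so every \<open>W\<^sub>k\<close> is a
  bounded continuous function (lemma \<open>forcing_primitives\<close>). With \<open>w\<^sub>1 = W\<^sub>-\<^sub>1\<close> and
  \<open>w\<^sub>2 = - W\<^sub>0 - a W\<^sub>-\<^sub>2\<close> the terms of order \<open>1\<close> and \<open>\<epsilon>\<close> of the equation cancel, and what remains
  is \<open>(D + a \<epsilon>) (D + 1 / \<epsilon> - a \<epsilon>) u = \<epsilon> (S - a\<^sup>2 \<epsilon> u - y\<^sup>2 Q(\<epsilon> y))\<close>, where
  \<open>S = W\<^sub>2 + 2 a W\<^sub>0 + a\<^sup>2 W\<^sub>-\<^sub>2\<close> and \<open>g(\<alpha> + z) = g(\<alpha>) + a z + z\<^sup>2 Q(z)\<close>. The two rates \<open>a \<epsilon>\<close> and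
  \<open>1 / \<epsilon> - a \<epsilon>\<close> have product \<open>a - a\<^sup>2 \<epsilon>\<^sup>2\<close>; using it instead of \<open>a\<close> keeps the characteristic
  exponents explicit and costs only the harmless term \<open>a\<^sup>2 \<epsilon> u\<close>.

  The remaining equation is solved in a space of continuous functions. For \<open>Re \<mu> > 0\<close> the
  operator \<open>D + \<mu>\<close> is inverted there by integrating backwards along the flow,
  \<open>(D + \<mu>)\<^sup>-\<^sup>1 h (\<psi>) = \<integral>\<^sub>0\<^sup>\<infinity> e\<^sup>-\<^sup>\<mu>\<^sup>s h(\<psi> - s \<omega>) ds\<close>, with norm at most \<open>1 / Re \<mu>\<close>. By partial
  fractions the solution operator \<open>h \<mapsto> \<epsilon> ((D + a \<epsilon>) (D + 1 / \<epsilon> - a \<epsilon>))\<^sup>-\<^sup>1 h\<close> is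
  \<open>\<epsilon>\<^sup>2 / (1 - 2 a \<epsilon>\<^sup>2)\<close> times the difference of the two inverses, so its norm is of the order of
  \<open>|\<epsilon>|\<^sup>2 / Re \<epsilon>\<close>. The tangent disc of radius \<open>R\<close> is exactly the set where \<open>|\<epsilon>|\<^sup>2 < 2 R Re \<epsilon>\<close>;
  hence the norm is \<open>O(R)\<close> uniformly on the disc (lemma \<open>norm_oscillator_inverse_le\<close>), and for
  small \<open>R\<close> the equation for \<open>u\<close> is a fixed point problem for a contraction of the unit ball
  (lemma \<open>corrector_exists\<close>). The iterates are jointly continuous, holomorphic in \<open>\<epsilon>\<close>,
  periodic and real for real \<open>\<epsilon>\<close>, and these properties pass to the uniform limit. The bound
  \<open>|u| \<le> 1\<close> gives \<open>x = \<alpha> + O(\<epsilon>)\<close>.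
\<close>

section \<open>Fourier series along the flow\<close>

lemma summable_exp_abs_int:
  assumes "\<eta> > 0"
  shows "(\<lambda>n::int. exp (- \<eta> * real_of_int \<bar>n\<bar>)) summable_on UNIV"
proof -
  let ?g = "\<lambda>n::int. exp (- \<eta> * real_of_int \<bar>n\<bar>)"
  have geo: "(\<lambda>n::nat. exp (- \<eta> * real n)) summable_on UNIV"
  proof -
    have "summable (\<lambda>n::nat. exp (- \<eta>) ^ n)"
      using assms by (intro summable_geometric) simp
    then have "summable (\<lambda>n::nat. norm (exp (- \<eta> * real n)))"
      by (simp add: exp_of_nat_mult[symmetric] mult.commute)
    then show ?thesis
      by (rule norm_summable_imp_summable_on)
  qed
  have "?g summable_on (range int)"
    using geo by (subst summable_on_reindex) (auto simp: o_def)
  moreover have "?g summable_on (range (\<lambda>n. - int n))"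
    using geo by (subst summable_on_reindex) (auto simp: o_def inj_on_def)
  ultimately have "?g summable_on (range int \<union> range (\<lambda>n. - int n))"
    by (rule summable_on_union)
  moreover have "range int \<union> range (\<lambda>n. - int n) = UNIV"
    by (auto simp: image_iff) (metis int_cases2)
  ultimately show ?thesis by simp
qed

text \<open>
  The exponential of the l1 norm is a product over the coordinates, so the lattice sum reduces
  to a product of one-dimensional geometric series.
\<close>

lemma summable_exp_norm_l1:
  assumes "\<eta> > 0"
  shows "(\<lambda>\<nu>::int ^ 'd::finite. exp (- \<eta> * norm_l1 \<nu>)) summable_on UNIV"
proof -
  let ?g = "\<lambda>n::int. exp (- \<eta> * real_of_int \<bar>n\<bar>)"
  have "Infinite_Set_Sum.abs_summable_on (\<lambda>h. \<Prod>i\<in>(UNIV::'d set). ?g (h i)) (PiE UNIV (\<lambda>_. UNIV))"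
    using summable_exp_abs_int[OF assms]
    by (intro abs_summable_on_prod_PiE) (auto simp: abs_summable_equivalent[symmetric])
  then have "(\<lambda>h. \<Prod>i\<in>(UNIV::'d set). ?g (h i)) summable_on UNIV"
    by (simp add: abs_summable_equivalent[symmetric] abs_prod)
  also have "(\<lambda>h. \<Prod>i\<in>(UNIV::'d set). ?g (h i))
      = (\<lambda>h. exp (- \<eta> * norm_l1 (vec_lambda h)))"
    by (simp add: norm_l1_def exp_sum[symmetric] sum_distrib_left)
  finally show ?thesis
    by (subst (asm) summable_on_reindex_bij_betw)
       (auto intro!: bij_betw_byWitness[where f' = vec_nth])
qed

lemma norm_l1_ge_1:
  assumes "\<nu> \<noteq> 0"
  shows "norm_l1 \<nu> \<ge> 1"
proof -
  obtain i where "\<nu> $ i \<noteq> 0"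
    using assms by (auto simp: vec_eq_iff)
  then have "1 \<le> real_of_int \<bar>\<nu> $ i\<bar>" by linarith
  also have "\<dots> \<le> norm_l1 \<nu>"
    unfolding norm_l1_def by (rule member_le_sum) auto
  finally show ?thesis .
qed

text \<open>
  This is \<open>ln x \<le> x\<close> at the point \<open>\<eta> x / \<beta>\<close>. It lets half of the exponential decay of the
  Fourier coefficients absorb the powers of \<open>|\<nu>|\<close> produced by small divisors and by
  differentiation.
\<close>

lemma powr_le_exp:
  fixes \<beta> \<eta> x :: real
  assumes "\<beta> > 0" "\<eta> > 0" "x > 0"
  shows "x powr \<beta> \<le> exp (\<beta> * ln (\<beta> / \<eta>)) * exp (\<eta> * x)"
proof -
  have "ln (\<eta> * x / \<beta>) \<le> \<eta> * x / \<beta>"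
    using ln_le_minus_one[of "\<eta> * x / \<beta>"] assms by simp
  then have "\<beta> * ln (\<eta> * x / \<beta>) \<le> \<eta> * x"
    using assms by (simp add: field_simps)
  moreover have "ln (\<eta> * x / \<beta>) = ln x - ln (\<beta> / \<eta>)"
    using assms by (simp add: ln_div ln_mult)
  ultimately have "\<beta> * ln x \<le> \<beta> * ln (\<beta> / \<eta>) + \<eta> * x"
    by (simp add: algebra_simps)
  then show ?thesis
    using assms by (simp add: powr_def exp_add[symmetric])
qed

definition torus_series :: "(int ^ 'd::finite \<Rightarrow> complex) \<Rightarrow> real ^ 'd \<Rightarrow> complex" where
  "torus_series b \<psi> =
     (\<Sum>\<^sub>\<infinity>\<nu>. exp (\<i> * complex_of_real (real_of_int_vec \<nu> \<bullet> \<psi>)) * b \<nu>)"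

lemma torus_series_summable:
  assumes "(\<lambda>\<nu>. norm (b \<nu>)) summable_on UNIV"
  shows "(\<lambda>\<nu>. exp (\<i> * complex_of_real (real_of_int_vec \<nu> \<bullet> \<psi>)) * b \<nu>) summable_on UNIV"
  by (rule abs_summable_summable) (use assms in \<open>simp add: norm_mult\<close>)

lemma norm_torus_series_le:
  assumes "(\<lambda>\<nu>. norm (b \<nu>)) summable_on UNIV"
  shows "norm (torus_series b \<psi>) \<le> (\<Sum>\<^sub>\<infinity>\<nu>. norm (b \<nu>))"
  unfolding torus_series_def
  by (rule order.trans[OF norm_infsum_bound]) (use assms in \<open>simp_all add: norm_mult\<close>)

lemma continuous_on_torus_series:
  assumes "(\<lambda>\<nu>. norm (b \<nu>)) summable_on UNIV"
  shows "continuous_on UNIV (torus_series b)"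
proof -
  have "uniform_limit UNIV
      (\<lambda>A \<psi>. \<Sum>\<nu>\<in>A. exp (\<i> * complex_of_real (real_of_int_vec \<nu> \<bullet> \<psi>)) * b \<nu>)
      (torus_series b) (finite_subsets_at_top UNIV)"
    unfolding torus_series_def
    by (rule Weierstrass_m_test_general[where M = "\<lambda>\<nu>. norm (b \<nu>)"])
       (use assms in \<open>simp_all add: norm_mult\<close>)
  then show ?thesis
    by (rule uniform_limit_theorem[rotated]) (auto intro!: always_eventually continuous_intros)
qed

lemma periodic_torus_series: "periodic_2pi (torus_series b)"
proof -
  have "exp (\<i> * complex_of_real (real_of_int_vec \<nu> \<bullet> (\<psi> + axis i (2 * pi))))
      = exp (\<i> * complex_of_real (real_of_int_vec \<nu> \<bullet> \<psi>))" for \<nu> :: "int ^ 'a" and \<psi> i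
  proof -
    have "real_of_int_vec \<nu> \<bullet> axis i (2 * pi) = 2 * pi * real_of_int (\<nu> $ i)"
      by (simp add: inner_axis real_of_int_vec_def)
    then have "\<i> * complex_of_real (real_of_int_vec \<nu> \<bullet> (\<psi> + axis i (2 * pi)))
      = \<i> * complex_of_real (real_of_int_vec \<nu> \<bullet> \<psi>) + of_int (\<nu> $ i) * (of_real pi * 2) * \<i>"
      by (simp add: inner_add_right algebra_simps)
    moreover have "exp (of_int (\<nu> $ i) * (of_real pi * 2) * \<i>) = (1 :: complex)"
      using exp_integer_2pi[of "of_int (\<nu> $ i)"] by (simp add: mult_ac)
    ultimately show ?thesis
      by (simp only: exp_add) simp
  qed
  then show ?thesis
    unfolding periodic_2pi_def torus_series_def by simp
qed

text \<open>
  Quadratic Taylor bound with a constant that is uniform on the whole line: near \<open>0\<close> it is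
  Taylor's formula, and away from \<open>0\<close> the linear bound \<open>2 + |x|\<close> is already below \<open>3 x\<^sup>2\<close>.
\<close>

lemma norm_exp_i_minus_affine:
  fixes x :: real
  shows "norm (exp (\<i> * complex_of_real x) - 1 - \<i> * complex_of_real x) \<le> 3 * x\<^sup>2"
proof (cases "\<bar>x\<bar> \<le> 1")
  case True
  have "norm (exp (\<i> * of_real x) - (\<Sum>j\<le>1. (\<i> * of_real x) ^ j / fact j))
      \<le> exp (norm (\<i> * complex_of_real x)) * (norm (\<i> * complex_of_real x) ^ Suc 1) / fact 1"
    by (rule Taylor_exp_field)
  also have "\<dots> = exp \<bar>x\<bar> * x\<^sup>2"
    by (simp add: norm_mult power2_eq_square)
  also have "\<dots> \<le> 3 * x\<^sup>2"
  proof (rule mult_right_mono)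
    have "exp \<bar>x\<bar> \<le> exp (1::real)" using True by simp
    then show "exp \<bar>x\<bar> \<le> 3" using exp_le by linarith
  qed simp
  finally show ?thesis by (simp add: algebra_simps)
next
  case False
  have "norm (exp (\<i> * complex_of_real x) - 1 - \<i> * complex_of_real x)
      \<le> norm (exp (\<i> * complex_of_real x)) + norm (1::complex) + norm (\<i> * complex_of_real x)"
    by (rule order.trans[OF norm_triangle_ineq4]) (simp add: order.trans[OF norm_triangle_ineq4])
  also have "\<dots> = 2 + \<bar>x\<bar>"
    by (simp add: norm_mult)
  also have "\<dots> \<le> 3 * x\<^sup>2"
  proof -
    have "\<bar>x\<bar> * 1 \<le> \<bar>x\<bar> * \<bar>x\<bar>" using False by (intro mult_left_mono) auto
    then show ?thesis using False by (simp add: power2_eq_square)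
  qed
  finally show ?thesis .
qed

lemma has_sum_diff:
  fixes f g :: "'a \<Rightarrow> 'b::real_normed_vector"
  assumes "(f has_sum x) A" "(g has_sum y) A"
  shows "((\<lambda>z. f z - g z) has_sum (x - y)) A"
  using has_sum_add[OF assms(1) has_sum_scaleR[OF assms(2), of "- 1"]] by simp

text \<open>
  Differentiation under the sum: the second-order Taylor bounds of the single modes are
  summable, which makes the remainder quadratic in the time increment. This is why absolute
  summability of the twice differentiated series is assumed.
\<close>

lemma torus_series_derivative_along_flow:
  fixes \<omega> :: "real ^ 'd::finite"
  assumes b0: "(\<lambda>\<nu>. norm (b \<nu>)) summable_on UNIV"
    and b1: "(\<lambda>\<nu>. norm ((\<i> * complex_of_real (\<omega> \<bullet> real_of_int_vec \<nu>)) * b \<nu>)) summable_on UNIV"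
    and b2: "(\<lambda>\<nu>. norm ((\<i> * complex_of_real (\<omega> \<bullet> real_of_int_vec \<nu>))\<^sup>2 * b \<nu>)) summable_on UNIV"
  shows "((\<lambda>t. torus_series b (t *\<^sub>R \<omega>)) has_vector_derivative
           torus_series (\<lambda>\<nu>. (\<i> * complex_of_real (\<omega> \<bullet> real_of_int_vec \<nu>)) * b \<nu>) (t *\<^sub>R \<omega>)) (at t)"
proof -
  let ?s = "\<lambda>\<nu>. \<omega> \<bullet> real_of_int_vec \<nu>"
  let ?b1 = "\<lambda>\<nu>. (\<i> * complex_of_real (?s \<nu>)) * b \<nu>"
  let ?b2 = "\<lambda>\<nu>. (\<i> * complex_of_real (?s \<nu>))\<^sup>2 * b \<nu>"
  let ?e = "\<lambda>\<nu> t. exp (\<i> * complex_of_real (real_of_int_vec \<nu> \<bullet> (t *\<^sub>R \<omega>)))"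
  define C where "C = 3 * (\<Sum>\<^sub>\<infinity>\<nu>. norm (?b2 \<nu>))"
  have C: "C * h\<^sup>2 = 3 * ((\<Sum>\<^sub>\<infinity>\<nu>. norm (?b2 \<nu>)) * h\<^sup>2)" for h
    by (simp add: C_def)
  have est: "norm (torus_series b ((t + h) *\<^sub>R \<omega>) - torus_series b (t *\<^sub>R \<omega>)
      - h *\<^sub>R torus_series ?b1 (t *\<^sub>R \<omega>)) \<le> C * h\<^sup>2" for h
  proof (unfold C, rule norm_infsum_le)
    show "((\<lambda>\<nu>. ?e \<nu> (t + h) * b \<nu> - ?e \<nu> t * b \<nu> - h *\<^sub>R (?e \<nu> t * ?b1 \<nu>)) has_sum
       (torus_series b ((t + h) *\<^sub>R \<omega>) - torus_series b (t *\<^sub>R \<omega>)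
         - h *\<^sub>R torus_series ?b1 (t *\<^sub>R \<omega>))) UNIV"
      unfolding torus_series_def
      by (intro has_sum_diff has_sum_scaleR has_sum_infsum torus_series_summable b0 b1)
    show "((\<lambda>\<nu>. 3 * (norm (?b2 \<nu>) * h\<^sup>2)) has_sum
       (3 * ((\<Sum>\<^sub>\<infinity>\<nu>. norm (?b2 \<nu>)) * h\<^sup>2))) UNIV"
      by (intro has_sum_cmult_right has_sum_cmult_left has_sum_infsum b2)
    fix \<nu> :: "int ^ 'd"
    let ?x = "h * ?s \<nu>"
    have "?e \<nu> (t + h) = ?e \<nu> t * exp (\<i> * complex_of_real ?x)"
      by (simp add: exp_add[symmetric] algebra_simps inner_commute)
    then have "?e \<nu> (t + h) * b \<nu> - ?e \<nu> t * b \<nu> - h *\<^sub>R (?e \<nu> t * ?b1 \<nu>)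
        = ?e \<nu> t * b \<nu> * (exp (\<i> * complex_of_real ?x) - 1 - \<i> * complex_of_real ?x)"
      by (simp add: algebra_simps scaleR_conv_of_real)
    then have "norm (?e \<nu> (t + h) * b \<nu> - ?e \<nu> t * b \<nu> - h *\<^sub>R (?e \<nu> t * ?b1 \<nu>))
        = norm (b \<nu>) * norm (exp (\<i> * complex_of_real ?x) - 1 - \<i> * complex_of_real ?x)"
      by (simp only: norm_mult norm_exp_i_times mult_1_left)
    also have "\<dots> \<le> norm (b \<nu>) * (3 * ?x\<^sup>2)"
      by (intro mult_left_mono norm_exp_i_minus_affine) auto
    also have "\<dots> = 3 * (norm (?b2 \<nu>) * h\<^sup>2)"
      by (simp add: norm_mult norm_power power_mult_distrib)
    finally show "norm (?e \<nu> (t + h) * b \<nu> - ?e \<nu> t * b \<nu> - h *\<^sub>R (?e \<nu> t * ?b1 \<nu>))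
        \<le> 3 * (norm (?b2 \<nu>) * h\<^sup>2)" .
  qed
  have "((\<lambda>h. C * \<bar>h\<bar>) \<longlongrightarrow> 0) (at 0)"
    by (auto intro!: tendsto_eq_intros)
  show ?thesis
    unfolding has_vector_derivative_def has_derivative_at
  proof (intro conjI bounded_linear_scaleR_left)
    show "(\<lambda>h. norm (torus_series b ((t + h) *\<^sub>R \<omega>) - torus_series b (t *\<^sub>R \<omega>)
      - h *\<^sub>R torus_series ?b1 (t *\<^sub>R \<omega>)) / norm h) \<midarrow>0\<rightarrow> 0"
    proof (rule Lim_null_comparison[OF _ \<open>((\<lambda>h. C * \<bar>h\<bar>) \<longlongrightarrow> 0) (at 0)\<close>])
      show "\<forall>\<^sub>F h in at 0. norm (norm (torus_series b ((t + h) *\<^sub>R \<omega>) - torus_series b (t *\<^sub>R \<omega>)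
        - h *\<^sub>R torus_series ?b1 (t *\<^sub>R \<omega>)) / norm h) \<le> C * \<bar>h\<bar>"
      proof (intro always_eventually allI)
        fix h
        show "norm (norm (torus_series b ((t + h) *\<^sub>R \<omega>) - torus_series b (t *\<^sub>R \<omega>)
          - h *\<^sub>R torus_series ?b1 (t *\<^sub>R \<omega>)) / norm h) \<le> C * \<bar>h\<bar>"
        proof (cases "h = 0")
          case False
          have "C * h\<^sup>2 = C * \<bar>h\<bar> * \<bar>h\<bar>"
            by (simp add: power2_eq_square)
          from est[of h, unfolded this] show ?thesis
            using False by (simp add: pos_divide_le_eq)
        qed simp
      qed
    qed
  qed
qed

text \<open>
  The mean is removed because it has no primitive. The exponent \<open>k\<close> is an integer so that
  derivatives and primitives along the flow are treated together.
\<close>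

definition flow_coeff ::
    "(int ^ 'd::finite \<Rightarrow> complex) \<Rightarrow> real ^ 'd \<Rightarrow> int \<Rightarrow> int ^ 'd \<Rightarrow> complex" where
  "flow_coeff c \<omega> k \<nu> =
     (if \<nu> = 0 then 0 else (\<i> * complex_of_real (\<omega> \<bullet> real_of_int_vec \<nu>)) powi k * c \<nu>)"

lemma abs_frequency_le:
  "\<bar>\<omega> \<bullet> real_of_int_vec \<nu>\<bar> \<le> norm \<omega> * norm_l1 \<nu>"
proof -
  have "\<bar>\<omega> \<bullet> real_of_int_vec \<nu>\<bar> \<le> (\<Sum>i\<in>UNIV. \<bar>\<omega> $ i * real_of_int (\<nu> $ i)\<bar>)"
    by (simp add: inner_vec_def real_of_int_vec_def)
  also have "\<dots> \<le> (\<Sum>i\<in>UNIV. norm \<omega> * real_of_int \<bar>\<nu> $ i\<bar>)"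
    by (intro sum_mono) (auto simp: abs_mult intro!: mult_right_mono component_le_norm_cart)
  finally show ?thesis
    by (simp add: norm_l1_def sum_distrib_left)
qed

lemma frequency_nonzero:
  assumes "C0 > 0" "diophantine C0 \<tau> \<omega>" "\<nu> \<noteq> 0"
  shows "\<omega> \<bullet> real_of_int_vec \<nu> \<noteq> 0"
proof -
  have "0 < C0 * norm_l1 \<nu> powr (- \<tau>)"
    using norm_l1_ge_1[OF assms(3)] assms(1) by simp
  then show ?thesis
    using assms(2,3) unfolding diophantine_def by fastforce
qed

text \<open>
  Multiplying by a power of the frequency, of either sign, costs at most a power of \<open>|\<nu>|\<close>:
  positive powers by the trivial upper bound for the frequency, negative ones by the
  Diophantine lower bound.
\<close>

lemma frequency_power_le:
  fixes \<omega> :: "real ^ 'd::finite"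
  assumes "C0 > 0" "\<tau> > 0" "diophantine C0 \<tau> \<omega>"
  obtains M \<beta> where "M \<ge> 0" "\<beta> > 0"
    "\<And>\<nu>. \<nu> \<noteq> 0 \<Longrightarrow>
       norm ((\<i> * complex_of_real (\<omega> \<bullet> real_of_int_vec \<nu>)) powi k) \<le> M * norm_l1 \<nu> powr \<beta>"
proof (cases k rule: int_cases2)
  case (nonneg m)
  show ?thesis
    \<comment> \<open>\<open>Suc m\<close> instead of \<open>m\<close> makes the exponent positive also for \<open>m = 0\<close>\<close>
  proof (rule that[of "norm \<omega> ^ m" "real (Suc m)"])
    fix \<nu> :: "int ^ 'd" assume "\<nu> \<noteq> 0"
    note n1 = norm_l1_ge_1[OF this]
    have "norm ((\<i> * complex_of_real (\<omega> \<bullet> real_of_int_vec \<nu>)) powi k)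
        = \<bar>\<omega> \<bullet> real_of_int_vec \<nu>\<bar> ^ m"
      by (simp add: nonneg norm_power norm_mult)
    also have "\<dots> \<le> (norm \<omega> * norm_l1 \<nu>) ^ m"
      by (intro power_mono abs_frequency_le) auto
    also have "\<dots> = norm \<omega> ^ m * norm_l1 \<nu> powr real m"
      using n1 by (simp add: power_mult_distrib powr_realpow)
    also have "\<dots> \<le> norm \<omega> ^ m * norm_l1 \<nu> powr real (Suc m)"
      using n1 by (intro mult_left_mono powr_mono) auto
    finally show "norm ((\<i> * complex_of_real (\<omega> \<bullet> real_of_int_vec \<nu>)) powi k)
        \<le> norm \<omega> ^ m * norm_l1 \<nu> powr real (Suc m)" .
  qed auto
next
  case (nonpos m)
  show ?thesis
  proof (rule that[of "(1 / C0) ^ m" "\<tau> * real (Suc m)"])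
    fix \<nu> :: "int ^ 'd" assume nz: "\<nu> \<noteq> 0"
    note n1 = norm_l1_ge_1[OF this]
    have "norm ((\<i> * complex_of_real (\<omega> \<bullet> real_of_int_vec \<nu>)) powi k)
        = (1 / \<bar>\<omega> \<bullet> real_of_int_vec \<nu>\<bar>) ^ m"
      by (simp add: nonpos power_int_minus norm_power norm_mult norm_inverse divide_inverse power_inverse)
    also have "\<dots> \<le> (1 / C0 * norm_l1 \<nu> powr \<tau>) ^ m"
    proof (rule power_mono)
      have "C0 * norm_l1 \<nu> powr (- \<tau>) \<le> \<bar>\<omega> \<bullet> real_of_int_vec \<nu>\<bar>"
        using assms(3) nz by (simp add: diophantine_def)
      moreover have "0 < C0 * norm_l1 \<nu> powr (- \<tau>)"
        using n1 assms(1) by simp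
      ultimately have "1 / \<bar>\<omega> \<bullet> real_of_int_vec \<nu>\<bar> \<le> 1 / (C0 * norm_l1 \<nu> powr (- \<tau>))"
        by (intro divide_left_mono) auto
      then show "1 / \<bar>\<omega> \<bullet> real_of_int_vec \<nu>\<bar> \<le> 1 / C0 * norm_l1 \<nu> powr \<tau>"
        by (simp add: powr_minus field_simps)
    qed auto
    also have "\<dots> = (1 / C0) ^ m * norm_l1 \<nu> powr (\<tau> * real m)"
      using n1 by (simp only: power_mult_distrib powr_powr[symmetric]) (simp add: powr_realpow)
    also have "\<dots> \<le> (1 / C0) ^ m * norm_l1 \<nu> powr (\<tau> * real (Suc m))"
      using n1 assms by (intro mult_left_mono powr_mono) auto
    finally show "norm ((\<i> * complex_of_real (\<omega> \<bullet> real_of_int_vec \<nu>)) powi k)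
        \<le> (1 / C0) ^ m * norm_l1 \<nu> powr (\<tau> * real (Suc m))" .
  qed (use assms in auto)
qed

lemma flow_coeff_summable:
  fixes c :: "int ^ 'd::finite \<Rightarrow> complex"
  assumes "F > 0" "\<xi> > 0" and c: "\<And>\<nu>. norm (c \<nu>) \<le> F * exp (- \<xi> * norm_l1 \<nu>)"
    and "C0 > 0" "\<tau> > 0" "diophantine C0 \<tau> \<omega>"
  shows "(\<lambda>\<nu>. norm (flow_coeff c \<omega> k \<nu>)) summable_on UNIV"
proof -
  obtain M \<beta> where M: "M \<ge> 0" "\<beta> > 0" and
    bd: "\<And>\<nu>. \<nu> \<noteq> 0 \<Longrightarrow>
       norm ((\<i> * complex_of_real (\<omega> \<bullet> real_of_int_vec \<nu>)) powi k) \<le> M * norm_l1 \<nu> powr \<beta>"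
    using frequency_power_le[OF assms(4-6), of k] by metis
  define B where "B = exp (\<beta> * ln (\<beta> / (\<xi> / 2)))"
  have bound: "norm (flow_coeff c \<omega> k \<nu>) \<le> M * B * F * exp (- (\<xi> / 2) * norm_l1 \<nu>)" for \<nu>
  proof (cases "\<nu> = 0")
    case False
    have "norm_l1 \<nu> powr \<beta> \<le> B * exp (\<xi> / 2 * norm_l1 \<nu>)"
      unfolding B_def using norm_l1_ge_1[OF False] M assms by (intro powr_le_exp) auto
    then have "norm ((\<i> * complex_of_real (\<omega> \<bullet> real_of_int_vec \<nu>)) powi k)
        \<le> M * (B * exp (\<xi> / 2 * norm_l1 \<nu>))"
      using bd[OF False] M(1) by (meson mult_left_mono order.trans)
    then have "norm (flow_coeff c \<omega> k \<nu>)
        \<le> M * (B * exp (\<xi> / 2 * norm_l1 \<nu>)) * (F * exp (- \<xi> * norm_l1 \<nu>))"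
      using False c M(1) by (auto simp: flow_coeff_def norm_mult B_def intro!: mult_mono)
    also have "exp (- \<xi> * norm_l1 \<nu>) = exp (- (\<xi> / 2) * norm_l1 \<nu>) * exp (- (\<xi> / 2) * norm_l1 \<nu>)"
      by (simp add: exp_add[symmetric])
    finally show ?thesis
      by (simp add: exp_minus field_simps)
  qed (use M assms in \<open>simp add: flow_coeff_def B_def\<close>)
  have "(\<lambda>\<nu>::int ^ 'd. M * B * F * exp (- (\<xi> / 2) * norm_l1 \<nu>)) summable_on UNIV"
    using assms by (intro summable_on_cmult_right summable_exp_norm_l1) simp
  from Infinite_Sum.abs_summable_on_comparison_test'[OF this bound] show ?thesis .
qed

text \<open>
  Used to see that the average of a real function is real: the imaginary part of a bounded
  primitive has constant slope.
\<close>

lemma constant_slope_bounded_imp_zero: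
  fixes y :: "real \<Rightarrow> real"
  assumes deriv: "\<And>t. (y has_real_derivative m) (at t)" and bound: "\<And>t. \<bar>y t\<bar> \<le> B"
  shows "m = 0"
proof (rule ccontr)
  assume "m \<noteq> 0"
  have "((\<lambda>t. y t - m * t) has_real_derivative 0) (at t)" for t
    using deriv[of t] by (auto intro!: derivative_eq_intros)
  then have "y t - m * t = y 0 - m * 0" for t
    using DERIV_isconst_all by blast
  from this[of "(2 * B + 1) / m"] have "y ((2 * B + 1) / m) = y 0 + 2 * B + 1"
    using \<open>m \<noteq> 0\<close> by simp
  then show False
    using bound[of "(2 * B + 1) / m"] bound[of 0] by linarith
qed

text \<open>
  The function \<open>W k\<close> is the \<open>k\<close>-th derivative along the flow of the oscillating part of \<open>f\<close>,
  for negative \<open>k\<close> a primitive. The real parts of the Fourier series with coefficients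
  \<open>(i \<omega> \<bullet> \<nu>)\<^sup>k c \<nu>\<close> have this property. The imaginary part of the series for \<open>k = 0\<close> is the
  constant \<open>- Im (c 0)\<close>, and its primitive is bounded, so this constant vanishes.
\<close>

lemma forcing_primitives:
  fixes f :: "real ^ 'd::finite \<Rightarrow> real"
  assumes fourier: "has_fourier_series f c"
    and analytic: "F > 0" "\<xi> > 0" "\<And>\<nu>. norm (c \<nu>) \<le> F * exp (- \<xi> * norm_l1 \<nu>)"
    and dioph: "C0 > 0" "\<tau> > 0" "diophantine C0 \<tau> \<omega>"
  obtains W :: "int \<Rightarrow> real ^ 'd \<Rightarrow> real" where
    "\<And>k. continuous_on UNIV (W k)" "\<And>k. periodic_2pi (W k)"
    "\<And>k. \<exists>B. \<forall>\<psi>. \<bar>W k \<psi>\<bar> \<le> B"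
    "\<And>k t. ((\<lambda>t. W k (t *\<^sub>R \<omega>)) has_real_derivative W (k + 1) (t *\<^sub>R \<omega>)) (at t)"
    "\<And>\<psi>. f \<psi> = Re (c 0) + W 0 \<psi>" "Im (c 0) = 0"
proof -
  define E where "E k = torus_series (flow_coeff c \<omega> k)" for k
  note sm = flow_coeff_summable[OF analytic dioph]
  have shift: "(\<i> * complex_of_real (\<omega> \<bullet> real_of_int_vec \<nu>)) * flow_coeff c \<omega> k \<nu>
      = flow_coeff c \<omega> (k + 1) \<nu>" for k \<nu>
    using frequency_nonzero[OF dioph(1,3), of \<nu>]
    by (auto simp: flow_coeff_def power_int_add)
  have shift2: "(\<i> * complex_of_real (\<omega> \<bullet> real_of_int_vec \<nu>))\<^sup>2 * flow_coeff c \<omega> k \<nu>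
      = flow_coeff c \<omega> (k + 2) \<nu>" for k \<nu>
    using shift[of \<nu> k] shift[of \<nu> "k + 1"] by (simp add: power2_eq_square mult.assoc add.assoc)
  have deriv: "((\<lambda>t. E k (t *\<^sub>R \<omega>)) has_vector_derivative E (k + 1) (t *\<^sub>R \<omega>)) (at t)" for k t
    unfolding E_def
    using torus_series_derivative_along_flow[of "flow_coeff c \<omega> k" \<omega> t] sm
    by (simp only: shift shift2)
  have dRe: "((\<lambda>t. Re (E k (t *\<^sub>R \<omega>))) has_real_derivative Re (E (k + 1) (t *\<^sub>R \<omega>))) (at t)" for k t
    using bounded_linear.has_vector_derivative[OF bounded_linear_Re deriv[of k t]]
    by (simp add: has_real_derivative_iff_has_vector_derivative)
  have dIm: "((\<lambda>t. Im (E k (t *\<^sub>R \<omega>))) has_real_derivative Im (E (k + 1) (t *\<^sub>R \<omega>))) (at t)" for k t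
    using bounded_linear.has_vector_derivative[OF bounded_linear_Im deriv[of k t]]
    by (simp add: has_real_derivative_iff_has_vector_derivative)
  have bound: "norm (E k \<psi>) \<le> (\<Sum>\<^sub>\<infinity>\<nu>. norm (flow_coeff c \<omega> k \<nu>))" for k \<psi>
    unfolding E_def by (rule norm_torus_series_le[OF sm])
  have split: "complex_of_real (f \<psi>) = c 0 + E 0 \<psi>" for \<psi>
  proof -
    let ?e = "\<lambda>\<nu>. exp (\<i> * complex_of_real (real_of_int_vec \<nu> \<bullet> \<psi>))"
    have "((\<lambda>\<nu>. ?e \<nu> * flow_coeff c \<omega> 0 \<nu>) has_sum E 0 \<psi>) UNIV"
      unfolding E_def torus_series_def by (intro has_sum_infsum torus_series_summable sm)
    moreover have "((\<lambda>\<nu>. if \<nu> = 0 then c 0 else 0) has_sum c 0) UNIV"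
      by (rule has_sum_finite_neutralI[of "{0}"]) auto
    ultimately have "((\<lambda>\<nu>. (if \<nu> = 0 then c 0 else 0) + ?e \<nu> * flow_coeff c \<omega> 0 \<nu>)
        has_sum (c 0 + E 0 \<psi>)) UNIV"
      by (intro has_sum_add)
    also have "(\<lambda>\<nu>. (if \<nu> = 0 then c 0 else 0) + ?e \<nu> * flow_coeff c \<omega> 0 \<nu>) = (\<lambda>\<nu>. ?e \<nu> * c \<nu>)"
      by (auto simp: flow_coeff_def real_of_int_vec_def inner_vec_def fun_eq_iff)
    finally show ?thesis
      using fourier unfolding has_fourier_series_def by (blast intro: has_sum_unique)
  qed
  show ?thesis
  proof (rule that[of "\<lambda>k \<psi>. Re (E k \<psi>)"])
    show "continuous_on UNIV (\<lambda>\<psi>. Re (E k \<psi>))" for k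
      unfolding E_def by (intro continuous_intros continuous_on_torus_series sm)
    show "periodic_2pi (\<lambda>\<psi>. Re (E k \<psi>))" for k
      using periodic_torus_series[of "flow_coeff c \<omega> k"] by (simp add: E_def periodic_2pi_def)
    show "\<exists>B. \<forall>\<psi>. \<bar>Re (E k \<psi>)\<bar> \<le> B" for k
      using order.trans[OF abs_Re_le_cmod bound[of k]] by auto
    show "((\<lambda>t. Re (E k (t *\<^sub>R \<omega>))) has_real_derivative Re (E (k + 1) (t *\<^sub>R \<omega>))) (at t)" for k t
      by (rule dRe)
    show "f \<psi> = Re (c 0) + Re (E 0 \<psi>)" for \<psi>
      using arg_cong[OF split, of Re] by simp
    have "Im (E 0 \<psi>) = - Im (c 0)" for \<psi>
      using arg_cong[OF split[of \<psi>], of Im] by simp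
    then have "((\<lambda>t. Im (E (- 1) (t *\<^sub>R \<omega>))) has_real_derivative - Im (c 0)) (at t)" for t
      using dIm[of "- 1" t] by simp
    then have "- Im (c 0) = 0"
      using order.trans[OF abs_Im_le_cmod bound[of "- 1"]]
      by (rule constant_slope_bounded_imp_zero)
    then show "Im (c 0) = 0" by simp
  qed
qed

section \<open>The resolvent of the flow derivative\<close>

text \<open>
  By Morera: exchanging the integrals turns the integral of the parameter integral over a
  triangle into an integral of triangle integrals, each of which vanishes by Cauchy's theorem.
\<close>

lemma holomorphic_integral_parameter:
  fixes G :: "complex \<Rightarrow> real \<Rightarrow> complex"
  assumes cont: "continuous_on (D \<times> {0..r}) (\<lambda>(\<epsilon>, s). G \<epsilon> s)"
    and hol: "\<And>s. s \<in> {0..r} \<Longrightarrow> (\<lambda>\<epsilon>. G \<epsilon> s) holomorphic_on D" and "open D"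
  shows "(\<lambda>\<epsilon>. integral {0..r} (G \<epsilon>)) holomorphic_on D"
proof -
  let ?F = "\<lambda>\<epsilon>. integral {0..r} (G \<epsilon>)"
  have contF: "continuous_on D ?F"
    using integral_continuous_on_param[of D 0 r G] cont by simp
  have swap: "contour_integral (linepath a b) ?F
      = integral {0..r} (\<lambda>s. contour_integral (linepath a b) (\<lambda>\<epsilon>. G \<epsilon> s))"
    "(\<lambda>s. contour_integral (linepath a b) (\<lambda>\<epsilon>. G \<epsilon> s)) integrable_on {0..r}"
    if "closed_segment a b \<subseteq> D" for a b
  proof -
    have "continuous_on ({0..1} \<times> {0..r}) ((\<lambda>(\<epsilon>, s). G \<epsilon> s) \<circ> (\<lambda>(x, s). (linepath a b x, s)))"
    proof (rule continuous_on_compose)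
      show "continuous_on ({0..1} \<times> {0..r}) (\<lambda>(x, s). (linepath a b x, s))"
        unfolding linepath_def case_prod_unfold by (intro continuous_intros)
      show "continuous_on ((\<lambda>(x, s). (linepath a b x, s)) ` ({0..1} \<times> {0..r})) (\<lambda>(\<epsilon>, s). G \<epsilon> s)"
        by (rule continuous_on_subset[OF cont])
           (use that in \<open>auto simp: linepath_in_path subset_iff\<close>)
    qed
    then have c: "continuous_on ({0..1} \<times> {0..r}) (\<lambda>(x, s). G (linepath a b x) s * (b - a))"
      unfolding case_prod_unfold o_def by (intro continuous_intros) auto
    have "contour_integral (linepath a b) ?F
        = integral {0..1} (\<lambda>x. integral {0..r} (\<lambda>s. G (linepath a b x) s * (b - a)))"
      by (simp add: contour_integral_integral)
    also have "\<dots> = integral {0..r} (\<lambda>s. integral {0..1} (\<lambda>x. G (linepath a b x) s * (b - a)))"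
      using integral_swap_continuous[of "0::real" "0::real" 1 r "\<lambda>x s. G (linepath a b x) s * (b - a)"] c
      by (simp add: cbox_Pair_eq)
    finally show "contour_integral (linepath a b) ?F
      = integral {0..r} (\<lambda>s. contour_integral (linepath a b) (\<lambda>\<epsilon>. G \<epsilon> s))"
      by (simp add: contour_integral_integral)
    have "continuous_on ({0..r} \<times> {0..1}) (\<lambda>(s, x). G (linepath a b x) s * (b - a))"
      using continuous_on_swap_args[OF c] .
    then have "continuous_on {0..r} (\<lambda>s. integral {0..1} (\<lambda>x. G (linepath a b x) s * (b - a)))"
      using integral_continuous_on_param[of "{0..r}" "0::real" 1 "\<lambda>s x. G (linepath a b x) s * (b - a)"]
      by simp
    then show "(\<lambda>s. contour_integral (linepath a b) (\<lambda>\<epsilon>. G \<epsilon> s)) integrable_on {0..r}"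
      by (simp add: contour_integral_integral integrable_continuous_interval)
  qed
  have "?F analytic_on D"
  proof (rule Morera_triangle[OF contF \<open>open D\<close>], intro impI)
    fix a b c assume sub: "convex hull {a, b, c} \<subseteq> D"
    have seg: "closed_segment a b \<subseteq> D" "closed_segment b c \<subseteq> D" "closed_segment c a \<subseteq> D"
      by (rule subset_trans[OF segments_subset_convex_hull(1) sub]
            subset_trans[OF segments_subset_convex_hull(3) sub]
            subset_trans[OF segments_subset_convex_hull(5) sub])+
    have "contour_integral (linepath a b) ?F + contour_integral (linepath b c) ?F
        + contour_integral (linepath c a) ?F
      = integral {0..r} (\<lambda>s. contour_integral (linepath a b) (\<lambda>\<epsilon>. G \<epsilon> s)
          + contour_integral (linepath b c) (\<lambda>\<epsilon>. G \<epsilon> s) + contour_integral (linepath c a) (\<lambda>\<epsilon>. G \<epsilon> s))"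
      using seg by (simp add: swap integral_add integrable_add)
    also have "\<dots> = integral {0..r} (\<lambda>s. 0)"
    proof (rule integral_cong)
      fix s assume "s \<in> {0..r}"
      then have h: "(\<lambda>\<epsilon>. G \<epsilon> s) holomorphic_on convex hull {a, b, c}"
        using hol sub holomorphic_on_subset by blast
      have "((\<lambda>\<epsilon>. G \<epsilon> s) has_contour_integral 0) (linepath a b +++ linepath b c +++ linepath c a)"
        by (rule Cauchy_theorem_triangle[OF h])
      then show "contour_integral (linepath a b) (\<lambda>\<epsilon>. G \<epsilon> s)
          + contour_integral (linepath b c) (\<lambda>\<epsilon>. G \<epsilon> s) + contour_integral (linepath c a) (\<lambda>\<epsilon>. G \<epsilon> s) = 0"
        by (rule has_chain_integral_chain_integral3)
    qed
    finally show "contour_integral (linepath a b) ?F + contour_integral (linepath b c) ?F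
        + contour_integral (linepath c a) ?F = 0"
      by simp
  qed
  then show ?thesis
    by (rule analytic_imp_holomorphic)
qed

text \<open>
  The inverse of \<open>D + \<mu>\<close> on continuous functions of the torus, where \<open>D\<close> is the derivative
  along \<open>\<omega>\<close> and \<open>Re \<mu> > 0\<close>.
\<close>

definition flow_resolvent ::
    "real ^ 'd::finite \<Rightarrow> complex \<Rightarrow> (real ^ 'd \<Rightarrow> complex) \<Rightarrow> real ^ 'd \<Rightarrow> complex" where
  "flow_resolvent \<omega> \<mu> h \<psi> =
     integral {0..} (\<lambda>s. exp (- (\<mu> * complex_of_real s)) * h (\<psi> - s *\<^sub>R \<omega>))"

lemma continuous_on_resolvent_integrand:
  fixes h :: "real ^ 'd::finite \<Rightarrow> complex"
  assumes "continuous_on UNIV h"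
  shows "continuous_on A (\<lambda>s. exp (- (\<mu> * complex_of_real s)) * h (\<psi> - s *\<^sub>R \<omega>))"
  by (intro continuous_intros continuous_on_compose2[OF assms]) auto

text \<open>
  The integrand is dominated by \<open>B e\<^sup>-\<^sup>R\<^sup>e\<^sup>\<mu>\<^sup>s\<close>. The tail integral from \<open>r\<close> is estimated for every
  \<open>r\<close>, because it controls the convergence of the truncated integrals.
\<close>

lemma resolvent_integrable:
  fixes h :: "real ^ 'd::finite \<Rightarrow> complex"
  assumes cont: "continuous_on UNIV h" and bound: "\<And>\<psi>. norm (h \<psi>) \<le> B" and \<mu>: "Re \<mu> > 0"
  shows "(\<lambda>s. exp (- (\<mu> * complex_of_real s)) * h (\<psi> - s *\<^sub>R \<omega>)) integrable_on {r..}" (is ?I)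
    and "norm (integral {r..} (\<lambda>s. exp (- (\<mu> * complex_of_real s)) * h (\<psi> - s *\<^sub>R \<omega>)))
      \<le> B * exp (- (Re \<mu> * r)) / Re \<mu>" (is ?N)
proof -
  let ?f = "\<lambda>s. exp (- (\<mu> * complex_of_real s)) * h (\<psi> - s *\<^sub>R \<omega>)"
  have le: "norm (?f s) \<le> B * exp (- (Re \<mu> * s))" for s
    using mult_right_mono[OF bound, of "exp (- (Re \<mu> * s))"] by (simp add: norm_mult mult.commute)
  have dom: "((\<lambda>s. B * exp (- (Re \<mu> * s))) has_integral B * (exp (- (Re \<mu> * r)) / Re \<mu>)) {r..}"
    using has_integral_exp_minus_to_infinity[OF \<mu>, of r] by (intro has_integral_mult_right) simp
  show ?I
  proof (rule measurable_bounded_by_integrable_imp_integrable)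
    show "?f \<in> borel_measurable (lebesgue_on {r..})"
      by (intro continuous_imp_measurable_on_sets_lebesgue continuous_on_resolvent_integrand cont) auto
    show "(\<lambda>s. B * exp (- (Re \<mu> * s))) integrable_on {r..}"
      using dom by (rule has_integral_integrable)
  qed (use le in auto)
  have "norm (integral {r..} ?f) \<le> integral {r..} (\<lambda>s. B * exp (- (Re \<mu> * s)))"
    using \<open>?I\<close> dom le by (intro integral_norm_bound_integral) (auto simp: has_integral_integrable)
  then show ?N
    using integral_unique[OF dom] by simp
qed

lemma norm_flow_resolvent_le:
  fixes h :: "real ^ 'd::finite \<Rightarrow> complex"
  assumes "continuous_on UNIV h" "\<And>\<psi>. norm (h \<psi>) \<le> B" "Re \<mu> > 0"
  shows "norm (flow_resolvent \<omega> \<mu> h \<psi>) \<le> B / Re \<mu>"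
  using resolvent_integrable(2)[OF assms, where r = 0 and \<psi> = \<psi> and \<omega> = \<omega>]
  by (simp add: flow_resolvent_def)

text \<open>
  The rate of convergence depends only on the bound for the function and on the real part of
  \<open>\<mu>\<close>, which makes the truncations converge uniformly on the torus and locally uniformly in
  parameters.
\<close>

lemma flow_resolvent_truncation:
  fixes h :: "real ^ 'd::finite \<Rightarrow> complex"
  assumes "continuous_on UNIV h" "\<And>\<psi>. norm (h \<psi>) \<le> B" "Re \<mu> > 0" "r \<ge> 0"
  shows "norm (flow_resolvent \<omega> \<mu> h \<psi>
      - integral {0..r} (\<lambda>s. exp (- (\<mu> * complex_of_real s)) * h (\<psi> - s *\<^sub>R \<omega>)))
      \<le> B * exp (- (Re \<mu> * r)) / Re \<mu>"
proof -
  let ?f = "\<lambda>s. exp (- (\<mu> * complex_of_real s)) * h (\<psi> - s *\<^sub>R \<omega>)"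
  have "(?f has_integral (integral {0..r} ?f + integral {r..} ?f)) ({0..r} \<union> {r..})"
  proof (rule has_integral_Un)
    show "negligible ({0..r} \<inter> {r..})"
      by (rule negligible_subset[of "{r}"]) auto
    show "(?f has_integral integral {0..r} ?f) {0..r}"
      by (intro integrable_integral integrable_continuous_interval
          continuous_on_resolvent_integrand assms)
    show "(?f has_integral integral {r..} ?f) {r..}"
      by (intro integrable_integral resolvent_integrable(1)[OF assms(1-3)])
  qed
  moreover have "{0..r} \<union> {r..} = {0..}"
    using \<open>r \<ge> 0\<close> by auto
  ultimately have "flow_resolvent \<omega> \<mu> h \<psi> = integral {0..r} ?f + integral {r..} ?f"
    by (simp add: flow_resolvent_def integral_unique)
  then show ?thesis
    using resolvent_integrable(2)[OF assms(1-3)] by simp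
qed

lemma flow_resolvent_diff:
  fixes h g :: "real ^ 'd::finite \<Rightarrow> complex"
  assumes "continuous_on UNIV h" "\<And>\<psi>. norm (h \<psi>) \<le> B"
    and "continuous_on UNIV g" "\<And>\<psi>. norm (g \<psi>) \<le> B'" and "Re \<mu> > 0"
  shows "flow_resolvent \<omega> \<mu> h \<psi> - flow_resolvent \<omega> \<mu> g \<psi> = flow_resolvent \<omega> \<mu> (\<lambda>\<psi>. h \<psi> - g \<psi>) \<psi>"
  unfolding flow_resolvent_def right_diff_distrib
  by (rule integral_diff[symmetric])
     (rule resolvent_integrable(1)[OF assms(1,2,5)] resolvent_integrable(1)[OF assms(3-5)])+

lemma flow_resolvent_real:
  fixes h :: "real ^ 'd::finite \<Rightarrow> complex"
  assumes "continuous_on UNIV h" "\<And>\<psi>. norm (h \<psi>) \<le> B" "Re \<mu> > 0"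
    and "\<mu> \<in> \<real>" "\<And>\<psi>. h \<psi> \<in> \<real>"
  shows "flow_resolvent \<omega> \<mu> h \<psi> \<in> \<real>"
proof -
  let ?f = "\<lambda>s. exp (- (\<mu> * complex_of_real s)) * h (\<psi> - s *\<^sub>R \<omega>)"
  have "Im (?f s) = 0" for s
    using assms(4,5)[THEN complex_is_Real_iff[THEN iffD1]] by (simp add: Im_exp)
  then have "integral {0..} (Im \<circ> ?f) = 0"
    by (simp add: o_def)
  then have "Im (integral {0..} ?f) = 0"
    using integral_linear[OF resolvent_integrable(1)[OF assms(1-3)] bounded_linear_Im] by simp
  then show ?thesis
    by (simp add: flow_resolvent_def complex_is_Real_iff)
qed

text \<open>
  The resolvent solves \<open>y' = h - \<mu> y\<close> along the flow. Let \<open>\<Phi>\<close> be a primitive of \<open>e\<^sup>\<mu>\<^sup>u h(u \<omega>)\<close>.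
  The integral truncated at \<open>r\<close> is \<open>e\<^sup>-\<^sup>\<mu>\<^sup>t (\<Phi> t - \<Phi> (t - r))\<close>. Its convergence as \<open>r\<close> grows says
  that \<open>\<Phi>\<close> has a limit \<open>K\<close> at minus infinity, which cannot depend on \<open>t\<close>. So the resolvent is
  \<open>e\<^sup>-\<^sup>\<mu>\<^sup>t (\<Phi> t - K)\<close>, which can be differentiated directly.
\<close>

lemma flow_resolvent_derivative:
  fixes h :: "real ^ 'd::finite \<Rightarrow> complex"
  assumes "continuous_on UNIV h" "\<And>\<psi>. norm (h \<psi>) \<le> B" "Re \<mu> > 0"
  shows "((\<lambda>t. flow_resolvent \<omega> \<mu> h (t *\<^sub>R \<omega>)) has_vector_derivative
           h (t *\<^sub>R \<omega>) - \<mu> * flow_resolvent \<omega> \<mu> h (t *\<^sub>R \<omega>)) (at t)"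
proof -
  let ?J = "\<lambda>t. flow_resolvent \<omega> \<mu> h (t *\<^sub>R \<omega>)"
  let ?\<phi> = "\<lambda>u. exp (\<mu> * complex_of_real u) * h (u *\<^sub>R \<omega>)"
  have "isCont ?\<phi> u" for u
  proof -
    have "continuous_on UNIV ?\<phi>"
      by (intro continuous_intros continuous_on_compose2[OF assms(1)]) auto
    then show ?thesis
      by (simp add: continuous_on_eq_continuous_at)
  qed
  then obtain \<Phi> where \<Phi>: "\<And>u. (\<Phi> has_vector_derivative ?\<phi> u) (at u)"
    using einterval_antiderivative[of "-\<infinity>" "\<infinity>" ?\<phi>] by auto
  have finite_part: "integral {0..r} (\<lambda>s. exp (- (\<mu> * complex_of_real s)) * h (t *\<^sub>R \<omega> - s *\<^sub>R \<omega>))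
      = exp (- (\<mu> * complex_of_real t)) * (\<Phi> t - \<Phi> (t - r))" if "r \<ge> 0" for r t
  proof -
    have "((\<lambda>s. - (exp (- (\<mu> * complex_of_real t)) * \<Phi> (t - s))) has_vector_derivative
        exp (- (\<mu> * complex_of_real s)) * h (t *\<^sub>R \<omega> - s *\<^sub>R \<omega>)) (at s within {0..r})" for s
    proof -
      have "((\<Phi> \<circ> (\<lambda>s. t - s)) has_vector_derivative (- 1) *\<^sub>R ?\<phi> (t - s)) (at s within {0..r})"
        by (rule vector_diff_chain_within[OF _ has_vector_derivative_at_within[OF \<Phi>]])
           (auto intro!: derivative_eq_intros)
      then have "((\<lambda>s. - (exp (- (\<mu> * complex_of_real t)) * \<Phi> (t - s))) has_vector_derivative
          - (exp (- (\<mu> * complex_of_real t)) * ((- 1) *\<^sub>R ?\<phi> (t - s)))) (at s within {0..r})"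
        unfolding o_def by (intro derivative_intros has_vector_derivative_mult_right)
      moreover have "- (exp (- (\<mu> * complex_of_real t)) * ((- 1) *\<^sub>R ?\<phi> (t - s)))
          = exp (- (\<mu> * complex_of_real s)) * h (t *\<^sub>R \<omega> - s *\<^sub>R \<omega>)"
        by (simp add: mult.assoc[symmetric] exp_add[symmetric] algebra_simps)
      ultimately show ?thesis by simp
    qed
    from fundamental_theorem_of_calculus[OF that this] show ?thesis
      by (simp add: integral_unique algebra_simps)
  qed
  \<comment> \<open>Solving the truncated identity for \<open>\<Phi> (t - r)\<close> shows that \<open>\<Phi>\<close> converges at minus infinity.\<close>
  have lim: "((\<lambda>r. \<Phi> (t - r)) \<longlongrightarrow> \<Phi> t - exp (\<mu> * complex_of_real t) * ?J t) at_top" for t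
  proof -
    have "((\<lambda>r. ?J t - integral {0..r} (\<lambda>s. exp (- (\<mu> * complex_of_real s)) * h (t *\<^sub>R \<omega> - s *\<^sub>R \<omega>)))
        \<longlongrightarrow> 0) at_top"
    proof (rule Lim_null_comparison)
      show "\<forall>\<^sub>F r in at_top. norm (?J t - integral {0..r}
          (\<lambda>s. exp (- (\<mu> * complex_of_real s)) * h (t *\<^sub>R \<omega> - s *\<^sub>R \<omega>))) \<le> B * exp (- (Re \<mu> * r)) / Re \<mu>"
        using eventually_ge_at_top[of 0] by eventually_elim (rule flow_resolvent_truncation[OF assms])
      show "((\<lambda>r. B * exp (- (Re \<mu> * r)) / Re \<mu>) \<longlongrightarrow> 0) at_top"
      proof -
        have "filterlim (\<lambda>r. Re \<mu> * r) at_top at_top"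
          using assms(3) by (intro filterlim_tendsto_pos_mult_at_top[OF tendsto_const]) (auto intro: filterlim_ident)
        then have "((\<lambda>r. exp (- (Re \<mu> * r))) \<longlongrightarrow> 0) at_top"
          by (intro filterlim_compose[OF exp_at_bot]) (simp add: filterlim_uminus_at_bot)
        then have "((\<lambda>r. B * exp (- (Re \<mu> * r)) / Re \<mu>) \<longlongrightarrow> B * 0 / Re \<mu>) at_top"
          using assms(3) by (intro tendsto_intros) auto
        then show ?thesis by simp
      qed
    qed
    then have "((\<lambda>r. ?J t - exp (- (\<mu> * complex_of_real t)) * (\<Phi> t - \<Phi> (t - r))) \<longlongrightarrow> 0) at_top"
      by (rule Lim_transform_eventually)
         (use eventually_ge_at_top[of 0] in \<open>eventually_elim, simp add: finite_part\<close>)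
    then have "((\<lambda>r. exp (\<mu> * complex_of_real t) * (?J t - exp (- (\<mu> * complex_of_real t)) * (\<Phi> t - \<Phi> (t - r)))
        + (\<Phi> t - exp (\<mu> * complex_of_real t) * ?J t)) \<longlongrightarrow>
        exp (\<mu> * complex_of_real t) * 0 + (\<Phi> t - exp (\<mu> * complex_of_real t) * ?J t)) at_top"
      by (intro tendsto_intros)
    moreover have "exp (\<mu> * complex_of_real t) * (?J t - exp (- (\<mu> * complex_of_real t)) * z)
        = exp (\<mu> * complex_of_real t) * ?J t - z" for z
      by (simp add: algebra_simps exp_minus)
    ultimately show ?thesis by simp
  qed
  have const: "\<Phi> t - exp (\<mu> * complex_of_real t) * ?J t = \<Phi> 0 - ?J 0" for t
  proof -
    have "filterlim (\<lambda>r. r + t) at_top (at_top :: real filter)"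
      using filterlim_tendsto_add_at_top[OF tendsto_const[of t] filterlim_ident] by (simp add: add.commute)
    from filterlim_compose[OF lim[of t] this] have "((\<lambda>r. \<Phi> (0 - r)) \<longlongrightarrow> \<Phi> t - exp (\<mu> * complex_of_real t) * ?J t) at_top"
      by simp
    from tendsto_unique[OF _ this lim[of 0]] show ?thesis by simp
  qed
  define K where "K = \<Phi> 0 - ?J 0"
  have J: "?J t = exp (- (\<mu> * complex_of_real t)) * (\<Phi> t - K)" for t
  proof -
    have "\<Phi> t - K = exp (\<mu> * complex_of_real t) * ?J t"
      using const[of t] by (simp add: K_def algebra_simps)
    then show ?thesis
      by (simp add: exp_minus)
  qed
  have e: "((\<lambda>t. exp (- (\<mu> * complex_of_real t))) has_vector_derivative
      - \<mu> * exp (- (\<mu> * complex_of_real t))) (at t)"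
    by (rule has_vector_derivative_real_field) (auto intro!: derivative_eq_intros)
  have "((\<lambda>t. exp (- (\<mu> * complex_of_real t)) * (\<Phi> t - K)) has_vector_derivative
      exp (- (\<mu> * complex_of_real t)) * (?\<phi> t - 0)
        + - \<mu> * exp (- (\<mu> * complex_of_real t)) * (\<Phi> t - K)) (at t)"
    by (intro has_vector_derivative_mult e has_vector_derivative_diff \<Phi> has_vector_derivative_const)
  moreover have "exp (- (\<mu> * complex_of_real t)) * (?\<phi> t - 0)
        + - \<mu> * exp (- (\<mu> * complex_of_real t)) * (\<Phi> t - K)
      = h (t *\<^sub>R \<omega>) - \<mu> * (exp (- (\<mu> * complex_of_real t)) * (\<Phi> t - K))"
    by (simp add: mult.assoc[symmetric] exp_add[symmetric])
  ultimately show ?thesis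
    unfolding J by (simp only:)
qed

section \<open>Families analytic in the small parameter\<close>

lemma analytic_torus_family_continuous:
  assumes "analytic_torus_family D H" "\<epsilon> \<in> D"
  shows "continuous_on UNIV (H \<epsilon>)"
proof -
  have "continuous_on UNIV ((\<lambda>(\<epsilon>, \<psi>). H \<epsilon> \<psi>) \<circ> (\<lambda>\<psi>. (\<epsilon>, \<psi>)))"
    using assms unfolding analytic_torus_family_def
    by (intro continuous_on_compose continuous_intros) (auto elim!: continuous_on_subset)
  then show ?thesis by (simp add: o_def)
qed

text \<open>
  Uniformity is required only near each parameter value, because truncated resolvents converge
  at a rate that may degenerate towards the boundary of the parameter domain.
\<close>

lemma analytic_torus_family_local_uniform_limit:
  fixes V :: "nat \<Rightarrow> complex \<Rightarrow> real ^ 'd::finite \<Rightarrow> complex"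
  assumes "open D"
    and cont: "\<And>n. continuous_on (D \<times> UNIV) (\<lambda>(\<epsilon>, \<psi>). V n \<epsilon> \<psi>)"
    and hol: "\<And>n \<psi>. (\<lambda>\<epsilon>. V n \<epsilon> \<psi>) holomorphic_on D"
    and lim: "\<And>\<epsilon>0. \<epsilon>0 \<in> D \<Longrightarrow> \<exists>r>0. cball \<epsilon>0 r \<subseteq> D \<and>
      uniform_limit (cball \<epsilon>0 r \<times> UNIV) (\<lambda>n (\<epsilon>, \<psi>). V n \<epsilon> \<psi>) (\<lambda>(\<epsilon>, \<psi>). W \<epsilon> \<psi>) sequentially"
    and per: "\<And>\<epsilon>. \<epsilon> \<in> D \<Longrightarrow> periodic_2pi (W \<epsilon>)"
  shows "analytic_torus_family D W"
  unfolding analytic_torus_family_def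
proof (intro conjI ballI allI per)
  show "continuous_on (D \<times> UNIV) (\<lambda>(\<epsilon>, \<psi>). W \<epsilon> \<psi>)"
  proof (rule continuous_at_imp_continuous_on, clarify)
    fix \<epsilon>0 and \<psi>0 :: "real ^ 'd" assume "\<epsilon>0 \<in> D"
    then obtain r where r: "r > 0" "cball \<epsilon>0 r \<subseteq> D" and
      ul: "uniform_limit (cball \<epsilon>0 r \<times> UNIV) (\<lambda>n (\<epsilon>, \<psi>). V n \<epsilon> \<psi>) (\<lambda>(\<epsilon>, \<psi>). W \<epsilon> \<psi>) sequentially"
      using lim by blast
    have "continuous_on (cball \<epsilon>0 r \<times> (UNIV :: (real ^ 'd) set)) (\<lambda>(\<epsilon>, \<psi>). W \<epsilon> \<psi>)"
      by (rule uniform_limit_theorem[OF always_eventually ul])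
         (use r(2) in \<open>auto intro!: continuous_on_subset[OF cont]\<close>)
    then have "continuous_on (ball \<epsilon>0 r \<times> (UNIV :: (real ^ 'd) set)) (\<lambda>(\<epsilon>, \<psi>). W \<epsilon> \<psi>)"
      by (rule continuous_on_subset) auto
    moreover have "open (ball \<epsilon>0 r \<times> (UNIV :: (real ^ 'd) set))"
      by (intro open_Times) auto
    ultimately show "isCont (\<lambda>(\<epsilon>, \<psi>). W \<epsilon> \<psi>) (\<epsilon>0, \<psi>0)"
      using r(1) by (auto simp: continuous_on_eq_continuous_at)
  qed
  show "(\<lambda>\<epsilon>. W \<epsilon> \<psi>) holomorphic_on D" for \<psi>
  proof (rule holomorphic_uniform_sequence[OF \<open>open D\<close> hol])
    fix \<epsilon>0 assume "\<epsilon>0 \<in> D"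
    then obtain r where r: "r > 0" "cball \<epsilon>0 r \<subseteq> D" and
      ul: "uniform_limit (cball \<epsilon>0 r \<times> UNIV) (\<lambda>n (\<epsilon>, \<psi>). V n \<epsilon> \<psi>) (\<lambda>(\<epsilon>, \<psi>). W \<epsilon> \<psi>) sequentially"
      using lim by blast
    have "uniform_limit (cball \<epsilon>0 r) (\<lambda>n \<epsilon>. V n \<epsilon> \<psi>) (\<lambda>\<epsilon>. W \<epsilon> \<psi>) sequentially"
      using ul unfolding uniform_limit_iff by (force elim!: eventually_mono)
    then show "\<exists>d>0. cball \<epsilon>0 d \<subseteq> D \<and>
        uniform_limit (cball \<epsilon>0 d) (\<lambda>n \<epsilon>. V n \<epsilon> \<psi>) (\<lambda>\<epsilon>. W \<epsilon> \<psi>) sequentially"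
      using r by blast
  qed
qed

text \<open>
  The truncated integrals are continuous and holomorphic, and on a compact disc around \<open>\<epsilon>\<^sub>0\<close>
  the minimum of \<open>Re (\<mu> \<epsilon>)\<close> is positive and gives a uniform rate of convergence.
\<close>

lemma flow_resolvent_family:
  fixes H :: "complex \<Rightarrow> real ^ 'd::finite \<Rightarrow> complex"
  assumes H: "analytic_torus_family D H" and "open D"
    and hol\<mu>: "\<mu> holomorphic_on D" and pos: "\<And>\<epsilon>. \<epsilon> \<in> D \<Longrightarrow> Re (\<mu> \<epsilon>) > 0"
    and bound: "\<And>\<epsilon> \<psi>. \<epsilon> \<in> D \<Longrightarrow> norm (H \<epsilon> \<psi>) \<le> B"
  shows "analytic_torus_family D (\<lambda>\<epsilon>. flow_resolvent \<omega> (\<mu> \<epsilon>) (H \<epsilon>))"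
proof -
  note contH = analytic_torus_family_continuous[OF H]
  have cH: "continuous_on (D \<times> UNIV) (\<lambda>(\<epsilon>, \<psi>). H \<epsilon> \<psi>)"
    and holH: "\<And>\<psi>. (\<lambda>\<epsilon>. H \<epsilon> \<psi>) holomorphic_on D"
    and perH: "\<And>\<epsilon>. \<epsilon> \<in> D \<Longrightarrow> periodic_2pi (H \<epsilon>)"
    using H by (auto simp: analytic_torus_family_def)
  have cont\<mu>: "continuous_on D \<mu>"
    using hol\<mu> by (rule holomorphic_on_imp_continuous_on)
  let ?g = "\<lambda>\<epsilon> \<psi> s. exp (- (\<mu> \<epsilon> * complex_of_real s)) * H \<epsilon> (\<psi> - s *\<^sub>R \<omega>)"
  let ?V = "\<lambda>n \<epsilon> \<psi>. integral {0..real n} (?g \<epsilon> \<psi>)"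
  have cg: "continuous_on ((D \<times> UNIV) \<times> {0..real n}) (\<lambda>(x, s). ?g (fst x) (snd x) s)" for n
    unfolding case_prod_unfold
    by (intro continuous_intros continuous_on_compose2[OF cont\<mu>]
        continuous_on_compose2[OF cH, where f = "\<lambda>x. (fst (fst x), snd (fst x) - snd x *\<^sub>R \<omega>)",
          unfolded case_prod_unfold fst_conv snd_conv]) auto
  show ?thesis
  proof (rule analytic_torus_family_local_uniform_limit[OF \<open>open D\<close>])
    show "continuous_on (D \<times> UNIV) (\<lambda>(\<epsilon>, \<psi>). ?V n \<epsilon> \<psi>)" for n
      using integral_continuous_on_param[of "D \<times> UNIV" 0 "real n" "\<lambda>x. ?g (fst x) (snd x)"] cg[of n]
      by (simp add: case_prod_unfold)
    show "(\<lambda>\<epsilon>. ?V n \<epsilon> \<psi>) holomorphic_on D" for n \<psi>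
    proof (rule holomorphic_integral_parameter[OF _ _ \<open>open D\<close>])
      have "continuous_on (D \<times> {0..real n}) (\<lambda>x. ((fst x, \<psi>), snd x))"
        by (intro continuous_intros)
      from continuous_on_compose2[OF cg[of n] this]
      show "continuous_on (D \<times> {0..real n}) (\<lambda>(\<epsilon>, s). ?g \<epsilon> \<psi> s)"
        by (simp add: case_prod_unfold image_subset_iff)
      show "(\<lambda>\<epsilon>. ?g \<epsilon> \<psi> s) holomorphic_on D" for s
        by (intro holomorphic_intros hol\<mu> holH)
    qed
    show "periodic_2pi (flow_resolvent \<omega> (\<mu> \<epsilon>) (H \<epsilon>))" if "\<epsilon> \<in> D" for \<epsilon>
    proof -
      have "H \<epsilon> (\<psi> + axis i (2 * pi) - s *\<^sub>R \<omega>) = H \<epsilon> (\<psi> - s *\<^sub>R \<omega>)" for \<psi> i s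
        using perH[OF that] unfolding periodic_2pi_def by (metis add_diff_eq add.commute diff_add_eq)
      then show ?thesis
        by (simp add: periodic_2pi_def flow_resolvent_def)
    qed
    fix \<epsilon>0 assume "\<epsilon>0 \<in> D"
    then obtain r where r: "r > 0" "cball \<epsilon>0 r \<subseteq> D"
      using \<open>open D\<close> open_contains_cball by blast
    have "continuous_on (cball \<epsilon>0 r) (\<lambda>\<epsilon>. Re (\<mu> \<epsilon>))"
      using r(2) by (intro continuous_intros continuous_on_subset[OF cont\<mu>])
    then obtain \<epsilon>1 where \<epsilon>1: "\<epsilon>1 \<in> cball \<epsilon>0 r" "\<And>\<epsilon>. \<epsilon> \<in> cball \<epsilon>0 r \<Longrightarrow> Re (\<mu> \<epsilon>1) \<le> Re (\<mu> \<epsilon>)"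
      using continuous_attains_inf[OF compact_cball, of \<epsilon>0 r "\<lambda>\<epsilon>. Re (\<mu> \<epsilon>)"] r(1) by auto
    define \<delta> where "\<delta> = Re (\<mu> \<epsilon>1)"
    have \<delta>: "\<delta> > 0"
      using pos \<epsilon>1(1) r(2) by (auto simp: \<delta>_def)
    have "B \<ge> 0"
      using bound[OF \<open>\<epsilon>0 \<in> D\<close>] norm_ge_zero order.trans by blast
    have est: "norm (flow_resolvent \<omega> (\<mu> \<epsilon>) (H \<epsilon>) \<psi> - ?V n \<epsilon> \<psi>) \<le> B / \<delta> * exp (- (\<delta> * real n))"
      if "\<epsilon> \<in> cball \<epsilon>0 r" for \<epsilon> \<psi> n
    proof -
      have "\<epsilon> \<in> D" using that r(2) by auto
      have "\<delta> \<le> Re (\<mu> \<epsilon>)" using \<epsilon>1(2)[OF that] by (simp add: \<delta>_def)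
      have "norm (flow_resolvent \<omega> (\<mu> \<epsilon>) (H \<epsilon>) \<psi> - ?V n \<epsilon> \<psi>)
          \<le> B * exp (- (Re (\<mu> \<epsilon>) * real n)) / Re (\<mu> \<epsilon>)"
        using flow_resolvent_truncation[OF contH bound pos, OF \<open>\<epsilon> \<in> D\<close> \<open>\<epsilon> \<in> D\<close> \<open>\<epsilon> \<in> D\<close>] by simp
      also have "\<dots> \<le> B * exp (- (\<delta> * real n)) / \<delta>"
        using \<open>B \<ge> 0\<close> \<delta> \<open>\<delta> \<le> Re (\<mu> \<epsilon>)\<close> by (intro frac_le mult_left_mono) (auto intro!: mult_right_mono)
      finally show ?thesis by simp
    qed
    have "(\<lambda>n. B / \<delta> * exp (- \<delta>) ^ n) \<longlonglongrightarrow> B / \<delta> * 0"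
      using \<delta> by (intro tendsto_mult tendsto_const LIMSEQ_power_zero) simp
    then have lim0: "(\<lambda>n. B / \<delta> * exp (- (\<delta> * real n))) \<longlonglongrightarrow> 0"
      by (simp add: exp_of_nat_mult[symmetric] mult.commute)
    have "uniform_limit (cball \<epsilon>0 r \<times> UNIV) (\<lambda>n (\<epsilon>, \<psi>). ?V n \<epsilon> \<psi>)
        (\<lambda>(\<epsilon>, \<psi>). flow_resolvent \<omega> (\<mu> \<epsilon>) (H \<epsilon>) \<psi>) sequentially"
    proof (rule uniform_limitI)
      fix e :: real assume "e > 0"
      show "\<forall>\<^sub>F n in sequentially. \<forall>x\<in>cball \<epsilon>0 r \<times> UNIV.
          dist (case x of (\<epsilon>, \<psi>) \<Rightarrow> ?V n \<epsilon> \<psi>)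
            (case x of (\<epsilon>, \<psi>) \<Rightarrow> flow_resolvent \<omega> (\<mu> \<epsilon>) (H \<epsilon>) \<psi>) < e"
        using order_tendstoD(2)[OF lim0 \<open>e > 0\<close>]
      proof eventually_elim
        case (elim n)
        show ?case
          using le_less_trans[OF est elim] by (auto simp: dist_commute dist_norm)
      qed
    qed
    then show "\<exists>r>0. cball \<epsilon>0 r \<subseteq> D \<and> uniform_limit (cball \<epsilon>0 r \<times> UNIV) (\<lambda>n (\<epsilon>, \<psi>). ?V n \<epsilon> \<psi>)
        (\<lambda>(\<epsilon>, \<psi>). flow_resolvent \<omega> (\<mu> \<epsilon>) (H \<epsilon>) \<psi>) sequentially"
      using r by blast
  qed
qed

section \<open>A contraction principle for families\<close>

definition real_on_reals :: "complex set \<Rightarrow> (complex \<Rightarrow> real ^ 'd::finite \<Rightarrow> complex) \<Rightarrow> bool" where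
  "real_on_reals D V \<longleftrightarrow> (\<forall>\<epsilon>\<in>D. \<forall>\<psi>. \<epsilon> \<in> \<real> \<longrightarrow> V \<epsilon> \<psi> \<in> \<real>)"

definition unit_torus_family :: "complex set \<Rightarrow> (complex \<Rightarrow> real ^ 'd::finite \<Rightarrow> complex) \<Rightarrow> bool" where
  "unit_torus_family D V \<longleftrightarrow>
     analytic_torus_family D V \<and> real_on_reals D V \<and> (\<forall>\<epsilon>\<in>D. \<forall>\<psi>. norm (V \<epsilon> \<psi>) \<le> 1)"

lemma unit_torus_family_uniform_limit:
  fixes V :: "nat \<Rightarrow> complex \<Rightarrow> real ^ 'd::finite \<Rightarrow> complex"
  assumes "open D" and V: "\<And>n. unit_torus_family D (V n)"
    and lim: "uniform_limit (D \<times> UNIV) (\<lambda>n (\<epsilon>, \<psi>). V n \<epsilon> \<psi>) (\<lambda>(\<epsilon>, \<psi>). W \<epsilon> \<psi>) sequentially"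
  shows "unit_torus_family D W"
proof -
  have pt: "(\<lambda>n. V n \<epsilon> \<psi>) \<longlonglongrightarrow> W \<epsilon> \<psi>" if "\<epsilon> \<in> D" for \<epsilon> \<psi>
    using tendsto_uniform_limitI[OF lim, of "(\<epsilon>, \<psi>)"] that by simp
  have "analytic_torus_family D W"
  proof (rule analytic_torus_family_local_uniform_limit[OF \<open>open D\<close>, where V = V])
    show "continuous_on (D \<times> UNIV) (\<lambda>(\<epsilon>, \<psi>). V n \<epsilon> \<psi>)" for n
      using V by (simp add: unit_torus_family_def analytic_torus_family_def)
    show "(\<lambda>\<epsilon>. V n \<epsilon> \<psi>) holomorphic_on D" for n \<psi>
      using V by (simp add: unit_torus_family_def analytic_torus_family_def)
    show "periodic_2pi (W \<epsilon>)" if "\<epsilon> \<in> D" for \<epsilon>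
      unfolding periodic_2pi_def
    proof (intro allI)
      fix \<psi> i
      have "V n \<epsilon> (\<psi> + axis i (2 * pi)) = V n \<epsilon> \<psi>" for n
        using V that by (simp add: unit_torus_family_def analytic_torus_family_def periodic_2pi_def)
      then show "W \<epsilon> (\<psi> + axis i (2 * pi)) = W \<epsilon> \<psi>"
        using LIMSEQ_unique[OF pt[OF that, of "\<psi> + axis i (2 * pi)"]] pt[OF that, of \<psi>] by simp
    qed
    fix \<epsilon>0 assume "\<epsilon>0 \<in> D"
    then obtain r where "r > 0" "cball \<epsilon>0 r \<subseteq> D"
      using \<open>open D\<close> open_contains_cball by blast
    moreover from this have "uniform_limit (cball \<epsilon>0 r \<times> UNIV) (\<lambda>n (\<epsilon>, \<psi>). V n \<epsilon> \<psi>)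
        (\<lambda>(\<epsilon>, \<psi>). W \<epsilon> \<psi>) sequentially"
      by (intro uniform_limit_on_subset[OF lim]) auto
    ultimately show "\<exists>r>0. cball \<epsilon>0 r \<subseteq> D \<and> uniform_limit (cball \<epsilon>0 r \<times> UNIV)
        (\<lambda>n (\<epsilon>, \<psi>). V n \<epsilon> \<psi>) (\<lambda>(\<epsilon>, \<psi>). W \<epsilon> \<psi>) sequentially"
      by blast
  qed
  moreover have "norm (W \<epsilon> \<psi>) \<le> 1" if "\<epsilon> \<in> D" for \<epsilon> \<psi>
    using V that by (intro Lim_bounded[OF tendsto_norm[OF pt[OF that]], of 0]) (auto simp: unit_torus_family_def)
  moreover have "W \<epsilon> \<psi> \<in> \<real>" if "\<epsilon> \<in> D" "\<epsilon> \<in> \<real>" for \<epsilon> \<psi>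
    using V that by (intro Lim_in_closed_set[OF closed_complex_Reals _ _ pt[OF that(1)]])
      (auto simp: unit_torus_family_def real_on_reals_def)
  ultimately show ?thesis
    by (simp add: unit_torus_family_def real_on_reals_def)
qed

text \<open>
  Banach's fixed point theorem for the sup norm, carried out by iteration from zero so that
  analyticity, continuity, periodicity and reality are inherited by the uniform limit.
\<close>

lemma unit_torus_family_fixed_point:
  fixes T :: "(complex \<Rightarrow> real ^ 'd::finite \<Rightarrow> complex) \<Rightarrow> complex \<Rightarrow> real ^ 'd \<Rightarrow> complex"
  assumes "open D"
    and maps: "\<And>V. unit_torus_family D V \<Longrightarrow> unit_torus_family D (T V)"
    and contr: "\<And>V W \<delta> \<epsilon> \<psi>. unit_torus_family D V \<Longrightarrow> unit_torus_family D W \<Longrightarrow>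
      (\<And>\<epsilon> \<psi>. \<epsilon> \<in> D \<Longrightarrow> norm (V \<epsilon> \<psi> - W \<epsilon> \<psi>) \<le> \<delta>) \<Longrightarrow> \<epsilon> \<in> D \<Longrightarrow>
      norm (T V \<epsilon> \<psi> - T W \<epsilon> \<psi>) \<le> \<delta> / 2"
  obtains V where "unit_torus_family D V" "\<And>\<epsilon> \<psi>. \<epsilon> \<in> D \<Longrightarrow> T V \<epsilon> \<psi> = V \<epsilon> \<psi>"
proof -
  define V where "V n = (T ^^ n) (\<lambda>_ _. 0)" for n
  have V_Suc: "V (Suc n) = T (V n)" for n
    by (simp add: V_def)
  have V: "unit_torus_family D (V n)" for n
  proof (induction n)
    case 0
    show ?case
      by (auto simp: V_def unit_torus_family_def analytic_torus_family_def real_on_reals_def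
          periodic_2pi_def case_prod_unfold)
  qed (simp add: V_Suc maps)
  \<comment> \<open>The iteration starts from zero and stays in the unit ball, so its first step has size at most \<open>1\<close>.\<close>
  have step: "norm (V (Suc n) \<epsilon> \<psi> - V n \<epsilon> \<psi>) \<le> (1 / 2) ^ n" if "\<epsilon> \<in> D" for n \<epsilon> \<psi>
    using that
  proof (induction n arbitrary: \<epsilon> \<psi>)
    case 0
    then show ?case
      using V[of 1] by (simp add: V_def unit_torus_family_def)
  next
    case (Suc n)
    show ?case
      using contr[OF V V Suc.IH Suc.prems] by (simp add: V_Suc)
  qed
  have "uniformly_convergent_on (D \<times> UNIV) (\<lambda>n x. \<Sum>k<n. V (Suc k) (fst x) (snd x) - V k (fst x) (snd x))"
    by (rule Weierstrass_m_test'[where M = "\<lambda>n. (1 / 2) ^ n"]) (auto intro: step)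
  moreover have "(\<Sum>k<n. V (Suc k) (fst x) (snd x) - V k (fst x) (snd x)) = V n (fst x) (snd x)" for n x
    by (subst sum_lessThan_telescope) (simp add: V_def)
  ultimately obtain W where "uniform_limit (D \<times> UNIV) (\<lambda>n x. V n (fst x) (snd x)) W sequentially"
    by (auto simp: uniformly_convergent_on_def)
  then have lim: "uniform_limit (D \<times> UNIV) (\<lambda>n (\<epsilon>, \<psi>). V n \<epsilon> \<psi>) (\<lambda>(\<epsilon>, \<psi>). W (\<epsilon>, \<psi>)) sequentially"
    by (simp add: case_prod_unfold)
  define U where "U \<epsilon> \<psi> = W (\<epsilon>, \<psi>)" for \<epsilon> \<psi>
  note lim = lim[folded U_def]
  have U: "unit_torus_family D U"
    by (rule unit_torus_family_uniform_limit[OF \<open>open D\<close> V lim])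
  have "T U \<epsilon> \<psi> = U \<epsilon> \<psi>" if "\<epsilon> \<in> D" for \<epsilon> \<psi>
  proof (rule LIMSEQ_unique)
    show "(\<lambda>n. V (Suc n) \<epsilon> \<psi>) \<longlonglongrightarrow> U \<epsilon> \<psi>"
      using tendsto_uniform_limitI[OF lim, of "(\<epsilon>, \<psi>)"] that by (intro LIMSEQ_Suc) simp
    show "(\<lambda>n. V (Suc n) \<epsilon> \<psi>) \<longlonglongrightarrow> T U \<epsilon> \<psi>"
    proof (rule LIMSEQ_I)
      fix e :: real assume "e > 0"
      then obtain N where N: "\<And>n x. n \<ge> N \<Longrightarrow> x \<in> D \<times> UNIV \<Longrightarrow>
          dist (case x of (\<epsilon>, \<psi>) \<Rightarrow> V n \<epsilon> \<psi>) (case x of (\<epsilon>, \<psi>) \<Rightarrow> U \<epsilon> \<psi>) < e"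
        using lim unfolding uniform_limit_iff eventually_sequentially by metis
      have "norm (V (Suc n) \<epsilon> \<psi> - T U \<epsilon> \<psi>) < e" if "n \<ge> N" for n
      proof -
        have "norm (V n \<epsilon>' \<psi>' - U \<epsilon>' \<psi>') \<le> e" if "\<epsilon>' \<in> D" for \<epsilon>' \<psi>'
          using N[OF \<open>n \<ge> N\<close>, of "(\<epsilon>', \<psi>')"] that by (simp add: dist_norm)
        from contr[OF V U this \<open>\<epsilon> \<in> D\<close>] have "norm (V (Suc n) \<epsilon> \<psi> - T U \<epsilon> \<psi>) \<le> e / 2"
          by (simp add: V_Suc)
        then show ?thesis using \<open>e > 0\<close> by simp
      qed
      then show "\<exists>N. \<forall>n\<ge>N. norm (V (Suc n) \<epsilon> \<psi> - T U \<epsilon> \<psi>) < e"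
        by blast
    qed
  qed
  with U show ?thesis by (rule that)
qed

text \<open>
  Taylor's formula to second order with an entire remainder factor, real on the real axis. The
  induction on \<open>n\<close> produces the recursion that this factor obeys.
\<close>

lemma power_shift_remainder:
  fixes \<alpha> :: real
  obtains Q :: "complex \<Rightarrow> complex" where "Q holomorphic_on UNIV" "\<And>z. z \<in> \<real> \<Longrightarrow> Q z \<in> \<real>"
    "\<And>z. (of_real \<alpha> + z) ^ n = of_real (\<alpha> ^ n) + of_real (real n * \<alpha> ^ (n - 1)) * z + z\<^sup>2 * Q z"
proof -
  have "\<exists>Q. Q holomorphic_on UNIV \<and> (\<forall>z\<in>\<real>. Q z \<in> \<real>) \<and> (\<forall>z::complex.
    (of_real \<alpha> + z) ^ n = of_real (\<alpha> ^ n) + of_real (real n * \<alpha> ^ (n - 1)) * z + z\<^sup>2 * Q z)"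
  proof (induction n)
    case 0
    show ?case by (intro exI[of _ "\<lambda>_. 0"]) auto
  next
    case (Suc n)
    then obtain Q where Q: "Q holomorphic_on UNIV" "\<And>z. z \<in> \<real> \<Longrightarrow> Q z \<in> \<real>"
      "\<And>z::complex. (of_real \<alpha> + z) ^ n
        = of_real (\<alpha> ^ n) + of_real (real n * \<alpha> ^ (n - 1)) * z + z\<^sup>2 * Q z"
      by blast
    let ?Q = "\<lambda>z. of_real (real n * \<alpha> ^ (n - 1)) + (of_real \<alpha> + z) * Q z"
    have "(of_real \<alpha> + z) ^ Suc n
        = of_real (\<alpha> ^ Suc n) + of_real (real (Suc n) * \<alpha> ^ (Suc n - 1)) * z + z\<^sup>2 * ?Q z" for z
    proof -
      define N where "N = complex_of_real (real n * \<alpha> ^ (n - 1))"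
      define P where "P = complex_of_real (\<alpha> ^ n)"
      have "real (Suc n) * \<alpha> ^ n = \<alpha> ^ n + \<alpha> * (real n * \<alpha> ^ (n - 1))"
        by (cases n) (auto simp: algebra_simps)
      then have c: "of_real (real (Suc n) * \<alpha> ^ n) = P + of_real \<alpha> * N"
        by (simp only: P_def N_def of_real_add of_real_mult)
      have "(of_real \<alpha> + z) ^ Suc n = (of_real \<alpha> + z) * (P + N * z + z\<^sup>2 * Q z)"
        by (simp only: power_Suc Q(3) P_def N_def)
      also have "\<dots> = of_real \<alpha> * P + (P + of_real \<alpha> * N) * z + z\<^sup>2 * (N + (of_real \<alpha> + z) * Q z)"
        by (simp add: algebra_simps power2_eq_square)
      finally show ?thesis
        unfolding c[symmetric] by (simp add: P_def N_def)
    qed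
    moreover have "?Q holomorphic_on UNIV"
      by (intro holomorphic_intros Q(1))
    moreover have "?Q z \<in> \<real>" if "z \<in> \<real>" for z
      using that by (intro Reals_add Reals_mult Q(2)) auto
    ultimately show ?case by blast
  qed
  then show ?thesis using that by blast
qed

text \<open>
  The nonlinearity \<open>y\<^sup>2 Q(\<epsilon> y)\<close> is bounded and Lipschitz in \<open>y\<close> on a disc, with the same
  constant for all \<open>|\<epsilon>| \<le> 1\<close>: its \<open>y\<close>-derivative involves \<open>Q\<close> and its derivative only at
  points of modulus at most \<open>Y\<close>.
\<close>

lemma quadratic_term_bounds:
  fixes Q :: "complex \<Rightarrow> complex"
  assumes "Q holomorphic_on UNIV" "Y \<ge> 0"
  obtains L where "L \<ge> 0"
    "\<And>\<epsilon> y. norm \<epsilon> \<le> 1 \<Longrightarrow> norm y \<le> Y \<Longrightarrow> norm (y\<^sup>2 * Q (\<epsilon> * y)) \<le> L"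
    "\<And>\<epsilon> y y'. norm \<epsilon> \<le> 1 \<Longrightarrow> norm y \<le> Y \<Longrightarrow> norm y' \<le> Y \<Longrightarrow>
       norm (y\<^sup>2 * Q (\<epsilon> * y) - y'\<^sup>2 * Q (\<epsilon> * y')) \<le> L * norm (y - y')"
proof -
  have bdd: "\<exists>B. \<forall>z. norm z \<le> Y \<longrightarrow> norm (g z) \<le> B" if "g holomorphic_on UNIV" for g :: "complex \<Rightarrow> complex"
  proof -
    have "continuous_on (cball 0 Y) g"
      using that holomorphic_on_imp_continuous_on continuous_on_subset by blast
    then have "bounded (g ` cball 0 Y)"
      by (intro compact_imp_bounded compact_continuous_image compact_cball)
    then show ?thesis
      by (metis (no_types, lifting) bounded_iff dist_0_norm image_eqI mem_cball)
  qed
  obtain q0 where q0: "\<And>z. norm z \<le> Y \<Longrightarrow> norm (Q z) \<le> q0"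
    using bdd[OF assms(1)] by blast
  obtain q1 where q1: "\<And>z. norm z \<le> Y \<Longrightarrow> norm (deriv Q z) \<le> q1"
    using bdd[OF holomorphic_deriv[OF assms(1) open_UNIV]] by blast
  have "q0 \<ge> 0"
    by (rule order.trans[OF norm_ge_zero q0[of 0]]) (simp add: \<open>Y \<ge> 0\<close>)
  have "q1 \<ge> 0"
    by (rule order.trans[OF norm_ge_zero q1[of 0]]) (simp add: \<open>Y \<ge> 0\<close>)
  have small: "norm (\<epsilon> * y) \<le> Y" if "norm \<epsilon> \<le> 1" "norm y \<le> Y" for \<epsilon> y :: complex
    using mult_mono[OF that] by (simp add: norm_mult)
  \<comment> \<open>one constant for both claims: the bound for the value plus the bound for the derivative\<close>
  define L where "L = Y\<^sup>2 * q0 + (2 * Y * q0 + Y\<^sup>2 * q1)"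
  show ?thesis
  proof (rule that[of L])
    show "L \<ge> 0"
      using \<open>q0 \<ge> 0\<close> \<open>q1 \<ge> 0\<close> \<open>Y \<ge> 0\<close> by (simp add: L_def)
    show "norm (y\<^sup>2 * Q (\<epsilon> * y)) \<le> L" if "norm \<epsilon> \<le> 1" "norm y \<le> Y" for \<epsilon> y
    proof -
      have "norm (y\<^sup>2 * Q (\<epsilon> * y)) \<le> Y\<^sup>2 * q0"
        unfolding norm_mult norm_power
        using that q0[OF small[OF that]] \<open>Y \<ge> 0\<close> by (intro mult_mono power_mono) auto
      then show ?thesis
        using \<open>q0 \<ge> 0\<close> \<open>q1 \<ge> 0\<close> \<open>Y \<ge> 0\<close> by (simp add: L_def add_increasing2)
    qed
    show "norm (y\<^sup>2 * Q (\<epsilon> * y) - y'\<^sup>2 * Q (\<epsilon> * y')) \<le> L * norm (y - y')"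
      if e: "norm \<epsilon> \<le> 1" and y: "norm y \<le> Y" "norm y' \<le> Y" for \<epsilon> y y'
    proof (rule field_differentiable_bound[where S = "cball 0 Y" and f = "\<lambda>y. y\<^sup>2 * Q (\<epsilon> * y)"
          and f' = "\<lambda>y. 2 * y * Q (\<epsilon> * y) + y\<^sup>2 * (deriv Q (\<epsilon> * y) * \<epsilon>)"])
      fix z :: complex assume "z \<in> cball 0 Y"
      then have z: "norm z \<le> Y" by simp
      have dQ: "(Q has_field_derivative deriv Q (\<epsilon> * z)) (at (\<epsilon> * z))"
        using assms(1) by (simp add: holomorphic_derivI)
      have "((\<lambda>y. Q (\<epsilon> * y)) has_field_derivative deriv Q (\<epsilon> * z) * \<epsilon>) (at z)"
        by (rule DERIV_chain2[where f = Q and g = "\<lambda>y. \<epsilon> * y", OF dQ]) (auto intro!: derivative_eq_intros)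
      then show "((\<lambda>y. y\<^sup>2 * Q (\<epsilon> * y)) has_field_derivative
          2 * z * Q (\<epsilon> * z) + z\<^sup>2 * (deriv Q (\<epsilon> * z) * \<epsilon>)) (at z within cball 0 Y)"
        by (rule has_field_derivative_at_within[OF DERIV_cong[OF DERIV_mult[OF DERIV_power[OF DERIV_ident]]]])
           (simp add: algebra_simps)
      have "norm (2 * z * Q (\<epsilon> * z)) \<le> 2 * Y * q0"
        unfolding norm_mult using z q0[OF small[OF e z]] \<open>Y \<ge> 0\<close> by (intro mult_mono) auto
      moreover have "norm (z\<^sup>2 * (deriv Q (\<epsilon> * z) * \<epsilon>)) \<le> Y\<^sup>2 * (q1 * 1)"
        unfolding norm_mult norm_power
        using z q1[OF small[OF e z]] e \<open>Y \<ge> 0\<close> \<open>q1 \<ge> 0\<close> by (intro mult_mono power_mono) auto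
      ultimately show "norm (2 * z * Q (\<epsilon> * z) + z\<^sup>2 * (deriv Q (\<epsilon> * z) * \<epsilon>)) \<le> L"
        using norm_triangle_ineq[of "2 * z * Q (\<epsilon> * z)" "z\<^sup>2 * (deriv Q (\<epsilon> * z) * \<epsilon>)"] \<open>q0 \<ge> 0\<close>
        by (simp add: L_def add_increasing)
    qed (use y in auto)
  qed
qed

section \<open>Inverting the linearised equation\<close>

text \<open>
  The operator \<open>\<epsilon> ((D + a \<epsilon>) (D + 1 / \<epsilon> - a \<epsilon>))\<^sup>-\<^sup>1\<close>, written by partial fractions. Composing
  the two resolvents instead would lose a factor \<open>|\<epsilon>| / Re \<epsilon>\<close> in the norm estimate, which is
  unbounded on a tangent disc.
\<close>

definition oscillator_inverse ::
    "real ^ 'd::finite \<Rightarrow> real \<Rightarrow> complex \<Rightarrow> (real ^ 'd \<Rightarrow> complex) \<Rightarrow> real ^ 'd \<Rightarrow> complex" where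
  "oscillator_inverse \<omega> a \<epsilon> h \<psi> = \<epsilon>\<^sup>2 / (1 - 2 * of_real a * \<epsilon>\<^sup>2) *
     (flow_resolvent \<omega> (of_real a * \<epsilon>) h \<psi> - flow_resolvent \<omega> (1 / \<epsilon> - of_real a * \<epsilon>) h \<psi>)"

text \<open>
  The bound \<open>R \<le> 1 / 2\<close> keeps \<open>|\<epsilon>|\<close> below \<open>1\<close>; the last one keeps the two rates apart, since
  it gives \<open>2 a |\<epsilon>|\<^sup>2 \<le> 1 / 2\<close>.
\<close>

definition disc_small :: "real \<Rightarrow> real \<Rightarrow> bool" where
  "disc_small a R \<longleftrightarrow> 0 < R \<and> R \<le> 1 / 2 \<and> 16 * a * R\<^sup>2 \<le> 1"

text \<open>
  The third estimate is the defining inequality of the disc, \<open>|\<epsilon> - R|\<^sup>2 < R\<^sup>2\<close>, expanded. It is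
  the geometric content of tangency to the imaginary axis: \<open>Re \<epsilon>\<close> dominates \<open>|\<epsilon>|\<^sup>2\<close>.
\<close>

lemma tangent_disc_bounds:
  assumes "\<epsilon> \<in> tangent_disc R"
  shows "0 < Re \<epsilon>" "\<epsilon> \<noteq> 0" "(norm \<epsilon>)\<^sup>2 < 2 * R * Re \<epsilon>" "norm \<epsilon> < 2 * R"
proof -
  have "norm (\<epsilon> - of_real R) < R"
    using assms by (simp add: tangent_disc_def dist_norm norm_minus_commute)
  then have "(norm (\<epsilon> - of_real R))\<^sup>2 < R\<^sup>2"
    by (intro power_strict_mono) auto
  then show 1: "(norm \<epsilon>)\<^sup>2 < 2 * R * Re \<epsilon>"
    unfolding cmod_power2 by (simp add: power2_eq_square algebra_simps)
  have "R > 0"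
    by (rule le_less_trans[OF norm_ge_zero \<open>norm (\<epsilon> - of_real R) < R\<close>])
  then show "0 < Re \<epsilon>"
    using le_less_trans[OF zero_le_power2 1] by (simp add: zero_less_mult_iff)
  then show "\<epsilon> \<noteq> 0" by auto
  have "norm \<epsilon> * norm \<epsilon> < 2 * R * norm \<epsilon>"
    using less_le_trans[OF 1 mult_left_mono[OF complex_Re_le_cmod]] \<open>R > 0\<close>
    by (simp add: power2_eq_square)
  then show "norm \<epsilon> < 2 * R"
    using \<open>\<epsilon> \<noteq> 0\<close> by simp
qed

text \<open>
  In terms of \<open>1 / \<epsilon>\<close> the tangent disc is the half plane \<open>Re (1 / \<epsilon>) > 1 / (2 R)\<close>, so the fast
  rate \<open>1 / \<epsilon> - a \<epsilon>\<close> is large. The slow rate \<open>a \<epsilon>\<close> has positive real part, although this is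
  not bounded below.
\<close>

lemma resolvent_rates:
  assumes "a > 0" "disc_small a R" and e: "\<epsilon> \<in> tangent_disc R"
  shows "Re (of_real a * \<epsilon>) > 0" "Re (1 / \<epsilon> - of_real a * \<epsilon>) \<ge> 1 / (4 * R)"
    "norm (1 - 2 * of_real a * \<epsilon>\<^sup>2) \<ge> 1 / 2"
proof -
  note t = tangent_disc_bounds[OF e]
  have R: "0 < R" "R \<le> 1 / 2" "16 * a * R\<^sup>2 \<le> 1"
    using assms(2) by (auto simp: disc_small_def)
  show "Re (of_real a * \<epsilon>) > 0"
    using t(1) \<open>a > 0\<close> by simp
  have "Re (1 / \<epsilon>) = Re \<epsilon> / (norm \<epsilon>)\<^sup>2"
    by (simp add: Re_divide cmod_power2)
  moreover have "Re \<epsilon> / (norm \<epsilon>)\<^sup>2 \<ge> 1 / (2 * R)"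
    using t(2,3) R(1) by (simp add: field_simps)
  moreover have "a * Re \<epsilon> \<le> 1 / (8 * R)"
  proof -
    have "a * Re \<epsilon> \<le> a * (2 * R)"
      using t(4) complex_Re_le_cmod[of \<epsilon>] \<open>a > 0\<close> by (intro mult_left_mono) auto
    also have "\<dots> \<le> 1 / (8 * R)"
      using R by (simp add: field_simps power2_eq_square)
    finally show ?thesis .
  qed
  moreover have "1 / (2 * R) - 1 / (8 * R) \<ge> 1 / (4 * R)"
    using R by (simp add: field_simps)
  ultimately show "Re (1 / \<epsilon> - of_real a * \<epsilon>) \<ge> 1 / (4 * R)"
    by simp
  have "norm (2 * of_real a * \<epsilon>\<^sup>2) = 2 * a * (norm \<epsilon>)\<^sup>2"
    using \<open>a > 0\<close> by (simp add: norm_mult norm_power)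
  also have "\<dots> \<le> 2 * a * (2 * R)\<^sup>2"
    using t(4) \<open>a > 0\<close> by (intro mult_left_mono power_mono) auto
  also have "\<dots> \<le> 1 / 2"
    using R by (simp add: power2_eq_square)
  finally show "norm (1 - 2 * of_real a * \<epsilon>\<^sup>2) \<ge> 1 / 2"
    using norm_triangle_ineq2[of 1 "2 * of_real a * \<epsilon>\<^sup>2"] by simp
qed

text \<open>
  The slow resolvent is only bounded by \<open>1 / (a Re \<epsilon>)\<close>, which is unbounded on the disc, but
  the prefactor of modulus about \<open>|\<epsilon>|\<^sup>2 < 2 R Re \<epsilon>\<close> compensates it. The resulting factor \<open>R\<close> is
  what makes the corrector equation a contraction.
\<close>

lemma norm_oscillator_inverse_le:
  fixes h :: "real ^ 'd::finite \<Rightarrow> complex"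
  assumes "a > 0" "disc_small a R" and e: "\<epsilon> \<in> tangent_disc R"
    and h: "continuous_on UNIV h" "\<And>\<psi>. norm (h \<psi>) \<le> B"
  shows "norm (oscillator_inverse \<omega> a \<epsilon> h \<psi>) \<le> (4 / a + 8) * R * B"
proof -
  note t = tangent_disc_bounds[OF e] and r = resolvent_rates[OF assms(1-3)]
  have R: "0 < R" "R \<le> 1 / 2"
    using assms(2) by (auto simp: disc_small_def)
  have B: "B \<ge> 0"
    using h(2) norm_ge_zero order.trans by blast
  have pos: "Re (1 / \<epsilon> - of_real a * \<epsilon>) > 0"
    using r(2) R(1) by (smt (verit) divide_pos_pos)
  have 1: "norm (flow_resolvent \<omega> (of_real a * \<epsilon>) h \<psi>) \<le> B / (a * Re \<epsilon>)"
    using norm_flow_resolvent_le[OF h r(1)] by simp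
  have "norm (flow_resolvent \<omega> (1 / \<epsilon> - of_real a * \<epsilon>) h \<psi>) \<le> B / Re (1 / \<epsilon> - of_real a * \<epsilon>)"
    using norm_flow_resolvent_le[OF h pos] .
  also have "\<dots> \<le> B / (1 / (4 * R))"
    using r(2) B R(1) by (intro divide_left_mono mult_pos_pos pos) auto
  finally have 2: "norm (flow_resolvent \<omega> (1 / \<epsilon> - of_real a * \<epsilon>) h \<psi>) \<le> 4 * R * B"
    by (simp add: mult.commute)
  have "norm (oscillator_inverse \<omega> a \<epsilon> h \<psi>)
      = (norm \<epsilon>)\<^sup>2 / norm (1 - 2 * of_real a * \<epsilon>\<^sup>2) * norm (flow_resolvent \<omega> (of_real a * \<epsilon>) h \<psi>
          - flow_resolvent \<omega> (1 / \<epsilon> - of_real a * \<epsilon>) h \<psi>)"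
    by (simp add: oscillator_inverse_def norm_mult norm_divide norm_power)
  also have "\<dots> \<le> (norm \<epsilon>)\<^sup>2 / (1 / 2) * (B / (a * Re \<epsilon>) + 4 * R * B)"
    using 1 2 r(3) norm_triangle_ineq4[of "flow_resolvent \<omega> (of_real a * \<epsilon>) h \<psi>"
        "flow_resolvent \<omega> (1 / \<epsilon> - of_real a * \<epsilon>) h \<psi>"]
    by (intro mult_mono divide_left_mono) auto
  also have "\<dots> = 2 * (norm \<epsilon>)\<^sup>2 * (B / (a * Re \<epsilon>)) + 8 * R * B * (norm \<epsilon>)\<^sup>2"
    by (simp add: algebra_simps)
  also have "\<dots> \<le> 4 / a * R * B + 8 * R * B * 1"
  proof (rule add_mono)
    have "2 * (norm \<epsilon>)\<^sup>2 * (B / (a * Re \<epsilon>)) \<le> 2 * (2 * R * Re \<epsilon>) * (B / (a * Re \<epsilon>))"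
      using t B \<open>a > 0\<close> by (intro mult_right_mono mult_left_mono) auto
    also have "\<dots> = 4 / a * R * B"
      using t(1) \<open>a > 0\<close> by (simp add: field_simps)
    finally show "2 * (norm \<epsilon>)\<^sup>2 * (B / (a * Re \<epsilon>)) \<le> 4 / a * R * B" .
    have "(norm \<epsilon>)\<^sup>2 \<le> 1"
      using t(4) R by (intro power_le_one) auto
    then show "8 * R * B * (norm \<epsilon>)\<^sup>2 \<le> 8 * R * B * 1"
      using R B by (intro mult_left_mono) auto
  qed
  finally show ?thesis
    by (simp add: algebra_simps)
qed

lemma oscillator_inverse_diff:
  fixes h g :: "real ^ 'd::finite \<Rightarrow> complex"
  assumes "a > 0" "disc_small a R" and e: "\<epsilon> \<in> tangent_disc R"
    and h: "continuous_on UNIV h" "\<And>\<psi>. norm (h \<psi>) \<le> B"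
    and g: "continuous_on UNIV g" "\<And>\<psi>. norm (g \<psi>) \<le> B'"
  shows "oscillator_inverse \<omega> a \<epsilon> h \<psi> - oscillator_inverse \<omega> a \<epsilon> g \<psi>
    = oscillator_inverse \<omega> a \<epsilon> (\<lambda>\<psi>. h \<psi> - g \<psi>) \<psi>"
proof -
  note r = resolvent_rates[OF assms(1-3)]
  have pos: "Re (1 / \<epsilon> - of_real a * \<epsilon>) > 0"
    using r(2) assms(2) by (smt (verit) divide_pos_pos disc_small_def)
  show ?thesis
    unfolding oscillator_inverse_def right_diff_distrib[symmetric]
      flow_resolvent_diff[OF h g r(1), symmetric] flow_resolvent_diff[OF h g pos, symmetric]
    by (simp add: algebra_simps)
qed

lemma analytic_torus_family_oscillator_inverse:
  fixes H :: "complex \<Rightarrow> real ^ 'd::finite \<Rightarrow> complex"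
  assumes "a > 0" "disc_small a R" and H: "analytic_torus_family (tangent_disc R) H"
    and bound: "\<And>\<epsilon> \<psi>. \<epsilon> \<in> tangent_disc R \<Longrightarrow> norm (H \<epsilon> \<psi>) \<le> B"
  shows "analytic_torus_family (tangent_disc R) (\<lambda>\<epsilon>. oscillator_inverse \<omega> a \<epsilon> (H \<epsilon>))"
proof -
  let ?D = "tangent_disc R"
  have "open ?D" by (simp add: tangent_disc_def)
  note r = resolvent_rates[OF assms(1,2)]
  have pos: "Re (1 / \<epsilon> - of_real a * \<epsilon>) > 0" if "\<epsilon> \<in> ?D" for \<epsilon>
    using r(2)[OF that] assms(2) by (smt (verit) divide_pos_pos disc_small_def)
  have nz: "2 * of_real a * \<epsilon>\<^sup>2 \<noteq> 1" if "\<epsilon> \<in> ?D" for \<epsilon>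
    using r(3)[OF that] by auto
  have "(\<lambda>\<epsilon>. of_real a * \<epsilon>) holomorphic_on ?D"
    by (intro holomorphic_intros)
  note F1 = flow_resolvent_family[OF H \<open>open ?D\<close> this r(1) bound, of \<omega>]
  have "(\<lambda>\<epsilon>. 1 / \<epsilon> - of_real a * \<epsilon>) holomorphic_on ?D"
    by (intro holomorphic_intros) (use tangent_disc_bounds in auto)
  note F2 = flow_resolvent_family[OF H \<open>open ?D\<close> this pos bound, of \<omega>]
  show ?thesis
    using F1 F2 unfolding analytic_torus_family_def oscillator_inverse_def case_prod_unfold
    by (auto simp: periodic_2pi_def nz intro!: continuous_intros holomorphic_intros)
qed

text \<open>
  With the rates \<open>\<mu> = a \<epsilon>\<close> and \<open>\<nu> = 1 / \<epsilon> - a \<epsilon>\<close>, whose sum is \<open>1 / \<epsilon>\<close>, both resolvents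
  satisfy first-order equations along the flow. In the first derivative of their difference
  the forcing cancels, which makes a second derivative possible although \<open>h\<close> is only
  continuous.
\<close>

lemma oscillator_inverse_solves:
  fixes h :: "real ^ 'd::finite \<Rightarrow> complex"
  assumes "a > 0" "disc_small a R" and e: "\<epsilon> \<in> tangent_disc R"
    and h: "continuous_on UNIV h" "\<And>\<psi>. norm (h \<psi>) \<le> B"
  obtains U' U'' where
    "\<And>t. ((\<lambda>t. oscillator_inverse \<omega> a \<epsilon> h (t *\<^sub>R \<omega>)) has_vector_derivative U' t) (at t)"
    "\<And>t. (U' has_vector_derivative U'' t) (at t)"
    "\<And>t. U'' t + 1 / \<epsilon> * U' t
      = \<epsilon> * h (t *\<^sub>R \<omega>) - (of_real a - (of_real a * \<epsilon>)\<^sup>2) * oscillator_inverse \<omega> a \<epsilon> h (t *\<^sub>R \<omega>)"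
proof -
  note r = resolvent_rates[OF assms(1-3)]
  define \<mu> where "\<mu> = of_real a * \<epsilon>"
  define \<nu> where "\<nu> = 1 / \<epsilon> - of_real a * \<epsilon>"
  define k where "k = \<epsilon>\<^sup>2 / (1 - 2 * of_real a * \<epsilon>\<^sup>2)"
  have nz: "\<epsilon> \<noteq> 0" "1 - 2 * of_real a * \<epsilon>\<^sup>2 \<noteq> 0"
    using r(3) tangent_disc_bounds[OF e] by auto
  have sum: "\<mu> + \<nu> = 1 / \<epsilon>" and prod: "\<mu> * \<nu> = of_real a - (of_real a * \<epsilon>)\<^sup>2"
    using nz by (auto simp: \<mu>_def \<nu>_def field_simps power2_eq_square)
  have k: "k * (\<nu> - \<mu>) = \<epsilon>"
    using nz by (simp add: \<mu>_def \<nu>_def k_def field_simps power2_eq_square)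
  have pos: "Re \<nu> > 0"
    using r(2) assms(2) unfolding \<nu>_def by (smt (verit) divide_pos_pos disc_small_def)
  define A where "A t = flow_resolvent \<omega> \<mu> h (t *\<^sub>R \<omega>)" for t
  define C where "C t = flow_resolvent \<omega> \<nu> h (t *\<^sub>R \<omega>)" for t
  define g where "g t = h (t *\<^sub>R \<omega>)" for t
  have U: "oscillator_inverse \<omega> a \<epsilon> h (t *\<^sub>R \<omega>) = k * (A t - C t)" for t
    by (simp add: oscillator_inverse_def k_def A_def C_def \<mu>_def \<nu>_def)
  have dA: "(A has_vector_derivative g t - \<mu> * A t) (at t)" for t
    using flow_resolvent_derivative[OF h r(1)[folded \<mu>_def]] by (simp add: A_def[abs_def] g_def)
  have dC: "(C has_vector_derivative g t - \<nu> * C t) (at t)" for t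
    using flow_resolvent_derivative[OF h pos] by (simp add: C_def[abs_def] g_def)
  show ?thesis
  proof (rule that)
    show "((\<lambda>t. oscillator_inverse \<omega> a \<epsilon> h (t *\<^sub>R \<omega>)) has_vector_derivative
        k * ((g t - \<mu> * A t) - (g t - \<nu> * C t))) (at t)" for t
      unfolding U by (intro has_vector_derivative_mult_right has_vector_derivative_diff dA dC)
    have "((\<lambda>t. k * (\<nu> * C t - \<mu> * A t)) has_vector_derivative
        k * (\<nu> * (g t - \<nu> * C t) - \<mu> * (g t - \<mu> * A t))) (at t)" for t
      by (intro has_vector_derivative_mult_right has_vector_derivative_diff dA dC)
    then show "((\<lambda>t. k * ((g t - \<mu> * A t) - (g t - \<nu> * C t))) has_vector_derivative
        k * (\<nu> * (g t - \<nu> * C t) - \<mu> * (g t - \<mu> * A t))) (at t)" for t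
      by simp
    show "k * (\<nu> * (g t - \<nu> * C t) - \<mu> * (g t - \<mu> * A t))
        + 1 / \<epsilon> * (k * ((g t - \<mu> * A t) - (g t - \<nu> * C t)))
      = \<epsilon> * h (t *\<^sub>R \<omega>) - (of_real a - (of_real a * \<epsilon>)\<^sup>2) * oscillator_inverse \<omega> a \<epsilon> h (t *\<^sub>R \<omega>)" for t
    proof -
      have "k * (\<nu> * (g t - \<nu> * C t) - \<mu> * (g t - \<mu> * A t))
          + (\<mu> + \<nu>) * (k * ((g t - \<mu> * A t) - (g t - \<nu> * C t)))
        = k * (\<nu> - \<mu>) * g t - (\<mu> * \<nu>) * (k * (A t - C t))"
        by (simp add: algebra_simps)
      then show ?thesis
        unfolding U k sum prod g_def .
    qed
  qed
qed

lemma oscillator_inverse_real: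
  fixes h :: "real ^ 'd::finite \<Rightarrow> complex"
  assumes "a > 0" "disc_small a R" and e: "\<epsilon> \<in> tangent_disc R"
    and h: "continuous_on UNIV h" "\<And>\<psi>. norm (h \<psi>) \<le> B"
    and real: "\<epsilon> \<in> \<real>" "\<And>\<psi>. h \<psi> \<in> \<real>"
  shows "oscillator_inverse \<omega> a \<epsilon> h \<psi> \<in> \<real>"
proof -
  note r = resolvent_rates[OF assms(1-3)]
  have pos: "Re (1 / \<epsilon> - of_real a * \<epsilon>) > 0"
    using r(2) assms(2) by (smt (verit) divide_pos_pos disc_small_def)
  show ?thesis
    unfolding oscillator_inverse_def
    using real by (intro Reals_mult Reals_diff Reals_divide Reals_power
        flow_resolvent_real[OF h r(1)] flow_resolvent_real[OF h pos]) auto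
qed

section \<open>The corrector\<close>

text \<open>
  The setting of the corrector equation: \<open>w1\<close> and \<open>w2\<close> are the coefficients found by
  averaging, \<open>S\<close> is the part of the remaining equation that does not involve the unknown, and
  \<open>Q\<close> is the entire factor of the quadratic part of the nonlinearity.
\<close>

locale averaged_oscillator =
  fixes \<omega> :: "real ^ 'd::finite" and a M :: real and w1 w2 S :: "real ^ 'd \<Rightarrow> real"
    and Q :: "complex \<Rightarrow> complex"
  assumes a_pos: "a > 0"
    and cont: "continuous_on UNIV w1" "continuous_on UNIV w2" "continuous_on UNIV S"
    and per: "periodic_2pi w1" "periodic_2pi w2" "periodic_2pi S"
    and bounds: "\<And>\<psi>. \<bar>w1 \<psi>\<bar> \<le> M" "\<And>\<psi>. \<bar>w2 \<psi>\<bar> \<le> M" "\<And>\<psi>. \<bar>S \<psi>\<bar> \<le> M"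
    and Q_hol: "Q holomorphic_on UNIV" and Q_real: "\<And>z. z \<in> \<real> \<Longrightarrow> Q z \<in> \<real>"
begin

definition profile :: "(complex \<Rightarrow> real ^ 'd \<Rightarrow> complex) \<Rightarrow> complex \<Rightarrow> real ^ 'd \<Rightarrow> complex" where
  "profile V \<epsilon> \<psi> = of_real (w1 \<psi>) + \<epsilon> * of_real (w2 \<psi>) + V \<epsilon> \<psi>"

text \<open>
  The right-hand side of the corrector equation, after division by \<open>\<epsilon>\<close>, with \<open>V\<close> in place of
  \<open>u\<close>.
\<close>

definition residual :: "(complex \<Rightarrow> real ^ 'd \<Rightarrow> complex) \<Rightarrow> complex \<Rightarrow> real ^ 'd \<Rightarrow> complex" where
  "residual V \<epsilon> \<psi> = of_real (S \<psi>) - (of_real a)\<^sup>2 * \<epsilon> * V \<epsilon> \<psi>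
     - (profile V \<epsilon> \<psi>)\<^sup>2 * Q (\<epsilon> * profile V \<epsilon> \<psi>)"

lemma analytic_torus_family_profile:
  assumes "analytic_torus_family D V"
  shows "analytic_torus_family D (profile V)"
proof -
  have "continuous_on (D \<times> UNIV) (\<lambda>p. w1 (snd p))" "continuous_on (D \<times> UNIV) (\<lambda>p. w2 (snd p))"
    by (auto intro!: continuous_on_compose2[OF cont(1)] continuous_on_compose2[OF cont(2)] continuous_intros)
  then show ?thesis
    using assms per unfolding analytic_torus_family_def profile_def case_prod_unfold
    by (auto simp: periodic_2pi_def intro!: continuous_intros holomorphic_intros)
qed

lemma analytic_torus_family_residual:
  assumes "analytic_torus_family D V"
  shows "analytic_torus_family D (residual V)"
  unfolding analytic_torus_family_def
proof (intro conjI ballI allI)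
  note P = analytic_torus_family_profile[OF assms]
  have S: "continuous_on (D \<times> UNIV) (\<lambda>p. S (snd p))"
    by (auto intro!: continuous_on_compose2[OF cont(3)] continuous_intros)
  have Q: "continuous_on (D \<times> UNIV) (\<lambda>p. Q (fst p * profile V (fst p) (snd p)))"
    using P by (auto intro!: continuous_on_compose2[OF holomorphic_on_imp_continuous_on[OF Q_hol]]
        continuous_intros simp: analytic_torus_family_def case_prod_unfold)
  show "continuous_on (D \<times> UNIV) (\<lambda>(\<epsilon>, \<psi>). residual V \<epsilon> \<psi>)"
    using S Q P assms unfolding residual_def case_prod_unfold analytic_torus_family_def
    by (intro continuous_intros) auto
  show "periodic_2pi (residual V \<epsilon>)" if "\<epsilon> \<in> D" for \<epsilon>
    using P assms per that by (auto simp: residual_def periodic_2pi_def analytic_torus_family_def)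
  fix \<psi>
  have "(Q \<circ> (\<lambda>\<epsilon>. \<epsilon> * profile V \<epsilon> \<psi>)) holomorphic_on D"
    using P by (intro holomorphic_on_compose_gen[OF _ Q_hol] holomorphic_intros)
      (auto simp: analytic_torus_family_def)
  then show "(\<lambda>\<epsilon>. residual V \<epsilon> \<psi>) holomorphic_on D"
    using P assms unfolding residual_def o_def analytic_torus_family_def
    by (intro holomorphic_intros) auto
qed

lemma residual_real:
  assumes "real_on_reals D V" "\<epsilon> \<in> D" "\<epsilon> \<in> \<real>"
  shows "profile V \<epsilon> \<psi> \<in> \<real>" "residual V \<epsilon> \<psi> \<in> \<real>"
proof -
  have V: "V \<epsilon> \<psi> \<in> \<real>"
    using assms by (simp add: real_on_reals_def)
  then show P: "profile V \<epsilon> \<psi> \<in> \<real>"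
    using assms(3) unfolding profile_def by (intro Reals_add Reals_mult) auto
  show "residual V \<epsilon> \<psi> \<in> \<real>"
    unfolding residual_def
    using assms(3) V P by (intro Reals_diff Reals_mult Reals_power Q_real) auto
qed

text \<open>
  The constants \<open>B\<close> and \<open>C R\<close> bound the residual and the solution operator. Since \<open>B\<close> also
  bounds the Lipschitz constant of the residual, the single requirement \<open>C R B \<le> 1 / 2\<close> gives
  both invariance of the unit ball and contraction.
\<close>

lemma corrector_exists:
  obtains R u B where "disc_small a R" "unit_torus_family (tangent_disc R) u"
    "\<And>\<epsilon> \<psi>. \<epsilon> \<in> tangent_disc R \<Longrightarrow> norm (residual u \<epsilon> \<psi>) \<le> B"
    "\<And>\<epsilon> \<psi>. \<epsilon> \<in> tangent_disc R \<Longrightarrow> oscillator_inverse \<omega> a \<epsilon> (residual u \<epsilon>) \<psi> = u \<epsilon> \<psi>"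
proof -
  have "M \<ge> 0"
    using bounds(1) abs_ge_zero order.trans by blast
  \<comment> \<open>\<open>Y\<close> bounds \<open>w1 + \<epsilon> w2 + V\<close> when \<open>|\<epsilon>| \<le> 1\<close> and \<open>|V| \<le> 1\<close>.\<close>
  define Y where "Y = 2 * M + 1"
  obtain L where L: "L \<ge> 0"
    "\<And>\<epsilon> y. norm \<epsilon> \<le> 1 \<Longrightarrow> norm y \<le> Y \<Longrightarrow> norm (y\<^sup>2 * Q (\<epsilon> * y)) \<le> L"
    "\<And>\<epsilon> y y'. norm \<epsilon> \<le> 1 \<Longrightarrow> norm y \<le> Y \<Longrightarrow> norm y' \<le> Y \<Longrightarrow>
       norm (y\<^sup>2 * Q (\<epsilon> * y) - y'\<^sup>2 * Q (\<epsilon> * y')) \<le> L * norm (y - y')"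
    using quadratic_term_bounds[OF Q_hol, of Y] \<open>M \<ge> 0\<close> unfolding Y_def by auto
  define B where "B = M + a\<^sup>2 + L"
  define C where "C = 4 / a + 8"
  have "B > 0" "C > 0"
    using \<open>M \<ge> 0\<close> L(1) a_pos by (auto simp: B_def C_def add_nonneg_pos add_pos_nonneg)
  \<comment> \<open>The first two entries ensure \<open>disc_small\<close>, the third one the contraction.\<close>
  define R where "R = min (1 / 2) (min (1 / (8 * a)) (1 / (2 * C * B)))"
  have "0 < R" "R \<le> 1 / 2"
    using a_pos \<open>B > 0\<close> \<open>C > 0\<close> by (auto simp: R_def)
  have "R \<le> 1 / (8 * a)" "R \<le> 1 / (2 * C * B)"
    by (auto simp: R_def)
  have CRB: "C * R * B \<le> 1 / 2"
    using \<open>R \<le> 1 / (2 * C * B)\<close> \<open>B > 0\<close> \<open>C > 0\<close> by (simp add: field_simps)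
  have small: "disc_small a R"
  proof -
    have "16 * a * R\<^sup>2 = (8 * a * R) * (2 * R)"
      by (simp add: power2_eq_square)
    also have "\<dots> \<le> 1 * 1"
      using \<open>R \<le> 1 / (8 * a)\<close> \<open>R \<le> 1 / 2\<close> \<open>0 < R\<close> a_pos by (intro mult_mono) (auto simp: field_simps)
    finally show ?thesis
      using \<open>0 < R\<close> \<open>R \<le> 1 / 2\<close> by (simp add: disc_small_def)
  qed
  let ?D = "tangent_disc R"
  have e1: "norm \<epsilon> \<le> 1" if "\<epsilon> \<in> ?D" for \<epsilon>
    using tangent_disc_bounds(4)[OF that] \<open>R \<le> 1 / 2\<close> by simp
  have prof: "norm (profile V \<epsilon> \<psi>) \<le> Y" if "unit_torus_family ?D V" "\<epsilon> \<in> ?D" for V \<epsilon> \<psi>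
  proof -
    have "norm (\<epsilon> * of_real (w2 \<psi>)) \<le> 1 * M"
      unfolding norm_mult using e1[OF that(2)] bounds(2) by (intro mult_mono) auto
    moreover have "norm (V \<epsilon> \<psi>) \<le> 1"
      using that by (simp add: unit_torus_family_def)
    moreover have "norm (complex_of_real (w1 \<psi>)) \<le> M"
      using bounds(1) by simp
    ultimately show ?thesis
      unfolding profile_def Y_def
      by (intro order.trans[OF norm_triangle_ineq] order.trans[OF add_mono[OF norm_triangle_ineq order.refl]]) simp
  qed
  have lin: "norm ((of_real a)\<^sup>2 * \<epsilon> * z) \<le> a\<^sup>2 * norm z" if "\<epsilon> \<in> ?D" for \<epsilon> z
    using mult_mono[OF mult_left_mono[OF e1[OF that], of "a\<^sup>2"] order.refl, of "norm z"]
    by (simp add: norm_mult norm_power)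
  have res: "norm (residual V \<epsilon> \<psi>) \<le> B" if V: "unit_torus_family ?D V" and e: "\<epsilon> \<in> ?D" for V \<epsilon> \<psi>
  proof -
    have "norm (V \<epsilon> \<psi>) \<le> 1"
      using that by (simp add: unit_torus_family_def)
    then have "norm ((of_real a)\<^sup>2 * \<epsilon> * V \<epsilon> \<psi>) \<le> a\<^sup>2"
      using order.trans[OF lin[OF e] mult_left_mono] by fastforce
    moreover have "norm (complex_of_real (S \<psi>)) \<le> M"
      using bounds(3) by simp
    moreover note L(2)[OF e1[OF e] prof[OF V e, of \<psi>]]
    ultimately show ?thesis
      unfolding residual_def B_def
      by (intro order.trans[OF norm_triangle_ineq4] add_mono order.trans[OF norm_triangle_ineq4])
  qed
  have res_diff: "norm (residual V \<epsilon> \<psi> - residual W \<epsilon> \<psi>) \<le> B * \<delta>"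
    if V: "unit_torus_family ?D V" and W: "unit_torus_family ?D W" and e: "\<epsilon> \<in> ?D"
      and d: "norm (V \<epsilon> \<psi> - W \<epsilon> \<psi>) \<le> \<delta>" for V W \<epsilon> \<psi> \<delta>
  proof -
    let ?d = "norm (V \<epsilon> \<psi> - W \<epsilon> \<psi>)"
    have "residual V \<epsilon> \<psi> - residual W \<epsilon> \<psi> = - ((of_real a)\<^sup>2 * \<epsilon> * (V \<epsilon> \<psi> - W \<epsilon> \<psi>))
        - ((profile V \<epsilon> \<psi>)\<^sup>2 * Q (\<epsilon> * profile V \<epsilon> \<psi>) - (profile W \<epsilon> \<psi>)\<^sup>2 * Q (\<epsilon> * profile W \<epsilon> \<psi>))"
      by (simp add: residual_def algebra_simps)
    also have "norm \<dots> \<le> a\<^sup>2 * ?d + L * norm (profile V \<epsilon> \<psi> - profile W \<epsilon> \<psi>)"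
      by (rule order.trans[OF norm_triangle_ineq4], unfold norm_minus_cancel,
          rule add_mono[OF lin[OF e] L(3)[OF e1[OF e] prof[OF V e] prof[OF W e]]])
    also have "profile V \<epsilon> \<psi> - profile W \<epsilon> \<psi> = V \<epsilon> \<psi> - W \<epsilon> \<psi>"
      by (simp add: profile_def)
    also have "a\<^sup>2 * ?d + L * ?d \<le> B * ?d"
      using \<open>M \<ge> 0\<close> by (simp add: B_def distrib_right)
    also have "\<dots> \<le> B * \<delta>"
      using d \<open>B > 0\<close> by simp
    finally show ?thesis .
  qed
  define T where "T V \<epsilon> = oscillator_inverse \<omega> a \<epsilon> (residual V \<epsilon>)" for V \<epsilon>
  have fam: "analytic_torus_family ?D (residual V)" if "unit_torus_family ?D V" for V
    using that analytic_torus_family_residual by (simp add: unit_torus_family_def)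
  note rcont = analytic_torus_family_continuous[OF fam]
  have "open ?D"
    by (simp add: tangent_disc_def)
  have maps: "unit_torus_family ?D (T V)" if V: "unit_torus_family ?D V" for V
    unfolding unit_torus_family_def
  proof (intro conjI ballI allI)
    show "analytic_torus_family ?D (T V)"
      unfolding T_def[abs_def]
      by (rule analytic_torus_family_oscillator_inverse[OF a_pos small fam[OF V] res[OF V]])
    show "real_on_reals ?D (T V)"
      using V residual_real(2)[of ?D V] unfolding T_def real_on_reals_def unit_torus_family_def
      by (auto intro!: oscillator_inverse_real[OF a_pos small _ rcont[OF V] res[OF V]])
    show "norm (T V \<epsilon> \<psi>) \<le> 1" if "\<epsilon> \<in> ?D" for \<epsilon> \<psi>
      using norm_oscillator_inverse_le[OF a_pos small that rcont[OF V that] res[OF V that], of \<omega> \<psi>] CRB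
      by (simp add: T_def C_def)
  qed
  have contr: "norm (T V \<epsilon> \<psi> - T W \<epsilon> \<psi>) \<le> \<delta> / 2"
    if V: "unit_torus_family ?D V" and W: "unit_torus_family ?D W"
      and d: "\<And>\<epsilon> \<psi>. \<epsilon> \<in> ?D \<Longrightarrow> norm (V \<epsilon> \<psi> - W \<epsilon> \<psi>) \<le> \<delta>" and e: "\<epsilon> \<in> ?D" for V W \<delta> \<epsilon> \<psi>
  proof -
    have "T V \<epsilon> \<psi> - T W \<epsilon> \<psi> = oscillator_inverse \<omega> a \<epsilon> (\<lambda>\<psi>. residual V \<epsilon> \<psi> - residual W \<epsilon> \<psi>) \<psi>"
      unfolding T_def
      by (rule oscillator_inverse_diff[OF a_pos small e rcont[OF V e] res[OF V e] rcont[OF W e] res[OF W e]])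
    also have "norm \<dots> \<le> C * R * (B * \<delta>)"
      unfolding C_def
      by (rule norm_oscillator_inverse_le[OF a_pos small e])
         (intro continuous_intros rcont V W e res_diff d)+
    also have "\<dots> \<le> \<delta> / 2"
    proof -
      have "\<delta> \<ge> 0"
        using d[OF e] norm_ge_zero order.trans by blast
      then show ?thesis
        using mult_right_mono[OF CRB, of \<delta>] by (simp add: mult.assoc)
    qed
    finally show ?thesis .
  qed
  obtain u where u: "unit_torus_family ?D u" "\<And>\<epsilon> \<psi>. \<epsilon> \<in> ?D \<Longrightarrow> T u \<epsilon> \<psi> = u \<epsilon> \<psi>"
  proof (rule unit_torus_family_fixed_point[OF \<open>open ?D\<close>, where T = T])
    show "unit_torus_family ?D (T V)" if "unit_torus_family ?D V" for V
      by (rule maps[OF that])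
    show "norm (T V \<epsilon> \<psi> - T W \<epsilon> \<psi>) \<le> \<delta> / 2"
      if "unit_torus_family ?D V" "unit_torus_family ?D W"
        "\<And>\<epsilon> \<psi>. \<epsilon> \<in> ?D \<Longrightarrow> norm (V \<epsilon> \<psi> - W \<epsilon> \<psi>) \<le> \<delta>" "\<epsilon> \<in> ?D" for V W \<delta> \<epsilon> \<psi>
      by (rule contr[OF that])
  qed blast
  show ?thesis
    by (rule that[OF small u(1) res[OF u(1)] u(2)[unfolded T_def]])
qed

end

section \<open>The quasi-periodic solution\<close>

theorem theorem1:
  fixes p :: nat
    and f :: "real ^ 'd::finite \<Rightarrow> real"
    and c :: "int ^ 'd \<Rightarrow> complex"
    and \<omega> :: "real ^ 'd"
    and F \<xi> C0 \<tau> :: real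
  assumes fourier: "has_fourier_series f c"
    and analytic: "F > 0" "\<xi> > 0" "\<And>\<nu>. norm (c \<nu>) \<le> F * exp (- \<xi> * norm_l1 \<nu>)"
    and average: "c 0 \<noteq> 0"
    and dioph: "C0 > 0" "\<tau> > real CARD('d) - 1" "diophantine C0 \<tau> \<omega>"
  shows "\<exists>\<gamma>0 > 0. \<exists>(x0 :: real \<Rightarrow> real \<Rightarrow> real) (X :: real \<Rightarrow> real ^ 'd \<Rightarrow> real).
           (\<forall>\<gamma> > \<gamma>0. solves_ode p \<gamma> (\<lambda>t. f (t *\<^sub>R \<omega>)) (x0 \<gamma>) \<and>
                     quasi_periodic_hull \<omega> (X \<gamma>) (x0 \<gamma>)) \<and>
           (\<exists>R > 0. \<exists>Z :: complex \<Rightarrow> real ^ 'd \<Rightarrow> complex.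
              analytic_torus_family (tangent_disc R) Z \<and>
              (\<forall>\<gamma> > \<gamma>0. complex_of_real (1 / \<gamma>) \<in> tangent_disc R \<and>
                        (\<forall>\<psi>. Z (complex_of_real (1 / \<gamma>)) \<psi> = complex_of_real (X \<gamma> \<psi>)))) \<and>
           odd_root_average p c \<noteq> 0 \<and>
           (\<exists>K. \<forall>\<gamma> > \<gamma>0. \<forall>t. \<bar>x0 \<gamma> t - odd_root_average p c\<bar> \<le> K / \<gamma>)"
proof -
  have "real CARD('d) \<ge> 1"
    by (simp add: Suc_le_eq)
  then have "\<tau> > 0"
    using dioph(2) by linarith
  from forcing_primitives[OF fourier analytic dioph(1) this dioph(3)]
  obtain W :: "int \<Rightarrow> real ^ 'd \<Rightarrow> real" where
    W_cont: "\<And>k. continuous_on UNIV (W k)" and W_per: "\<And>k. periodic_2pi (W k)"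
    and W_bdd: "\<And>k. \<exists>B. \<forall>\<psi>. \<bar>W k \<psi>\<bar> \<le> B"
    and W_deriv: "\<And>k t. ((\<lambda>t. W k (t *\<^sub>R \<omega>)) has_real_derivative W (k + 1) (t *\<^sub>R \<omega>)) (at t)"
    and f_eq: "\<And>\<psi>. f \<psi> = Re (c 0) + W 0 \<psi>" and "Im (c 0) = 0"
    by blast
  define \<alpha> where "\<alpha> = odd_root_average p c"
  have \<alpha>_pow: "\<alpha> ^ (2 * p + 1) = Re (c 0)"
    unfolding \<alpha>_def odd_root_average_def by (rule odd_real_root_pow) simp
  have "Re (c 0) \<noteq> 0"
    using average \<open>Im (c 0) = 0\<close> by (auto simp: complex_eq_iff)
  then have "\<alpha> \<noteq> 0"
    using \<alpha>_pow by auto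
  define a where "a = real (2 * p + 1) * \<alpha> ^ (2 * p)"
  have "a > 0"
    using \<open>\<alpha> \<noteq> 0\<close> by (simp add: a_def zero_less_power_eq)
  obtain Q :: "complex \<Rightarrow> complex" where Q: "Q holomorphic_on UNIV" "\<And>z. z \<in> \<real> \<Longrightarrow> Q z \<in> \<real>"
    "\<And>z. (of_real \<alpha> + z) ^ (2 * p + 1) = of_real (\<alpha> ^ (2 * p + 1)) + of_real a * z + z\<^sup>2 * Q z"
    using power_shift_remainder[where \<alpha> = \<alpha> and n = "2 * p + 1"] unfolding a_def by auto
  \<comment> \<open>\<open>w2\<close> is the primitive of \<open>- D\<^sup>2 w1 - a w1\<close>, for \<open>w1 = W (- 1)\<close>, which removes the terms of order
    \<open>1 / \<gamma>\<close>; \<open>S = - D\<^sup>2 w2 - a w2\<close> is what the terms of order \<open>1 / \<gamma>\<^sup>2\<close> leave over.\<close>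
  define w2 where "w2 \<psi> = - W 0 \<psi> - a * W (- 2) \<psi>" for \<psi>
  define S where "S \<psi> = W 2 \<psi> + 2 * a * W 0 \<psi> + a\<^sup>2 * W (- 2) \<psi>" for \<psi>
  obtain B where B: "\<And>k \<psi>. \<bar>W k \<psi>\<bar> \<le> B k"
    using W_bdd by metis
  have B0: "B k \<ge> 0" for k
    using B[of k 0] by linarith
  define M where "M = B (- 1) + B 0 + a * B (- 2) + B 2 + 2 * a * B 0 + a\<^sup>2 * B (- 2)"
  have scaled: "\<bar>s * W k \<psi>\<bar> \<le> s * B k" if "s \<ge> 0" for s k \<psi>
    using mult_left_mono[OF B that] that by (simp add: abs_mult)
  have nonneg: "a * B (- 2) \<ge> 0" "2 * a * B 0 \<ge> 0" "a\<^sup>2 * B (- 2) \<ge> 0"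
    using B0 \<open>a > 0\<close> by auto
  interpret averaged_oscillator \<omega> a M "W (- 1)" w2 S Q
  proof
    show "continuous_on UNIV w2" "continuous_on UNIV S"
      unfolding w2_def[abs_def] S_def[abs_def] by (intro continuous_intros W_cont)+
    show "periodic_2pi w2" "periodic_2pi S"
      using W_per by (auto simp: w2_def S_def periodic_2pi_def)
    show "\<bar>W (- 1) \<psi>\<bar> \<le> M" for \<psi>
      using B[of "- 1" \<psi>] B0[of 0] B0[of 2] nonneg unfolding M_def by linarith
    show "\<bar>w2 \<psi>\<bar> \<le> M" for \<psi>
      using B[of 0 \<psi>] scaled[of a "- 2" \<psi>] \<open>a > 0\<close> B0[of "- 1"] B0[of 2] nonneg
      unfolding M_def w2_def by linarith
    show "\<bar>S \<psi>\<bar> \<le> M" for \<psi>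
    proof -
      have "\<bar>2 * a * W 0 \<psi>\<bar> \<le> 2 * a * B 0" "\<bar>a\<^sup>2 * W (- 2) \<psi>\<bar> \<le> a\<^sup>2 * B (- 2)"
        using \<open>a > 0\<close> by (auto intro!: scaled)
      then show ?thesis
        using B[of 2 \<psi>] B0[of "- 1"] B0[of 0] nonneg unfolding M_def S_def by linarith
    qed
  qed (use \<open>a > 0\<close> W_cont W_per Q in auto)
  obtain R u G where R: "disc_small a R" and u: "unit_torus_family (tangent_disc R) u"
    and res_bound: "\<And>\<epsilon> \<psi>. \<epsilon> \<in> tangent_disc R \<Longrightarrow> norm (residual u \<epsilon> \<psi>) \<le> G"
    and fixed: "\<And>\<epsilon> \<psi>. \<epsilon> \<in> tangent_disc R \<Longrightarrow>
      oscillator_inverse \<omega> a \<epsilon> (residual u \<epsilon>) \<psi> = u \<epsilon> \<psi>"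
    using corrector_exists by blast
  let ?D = "tangent_disc R"
  have "R > 0" "R \<le> 1 / 2"
    using R by (auto simp: disc_small_def)
  have u_fam: "analytic_torus_family ?D u" and u_real: "real_on_reals ?D u"
    and u_le: "\<And>\<epsilon> \<psi>. \<epsilon> \<in> ?D \<Longrightarrow> norm (u \<epsilon> \<psi>) \<le> 1"
    using u by (auto simp: unit_torus_family_def)
  note P_fam = analytic_torus_family_profile[OF u_fam]
  note res_cont = analytic_torus_family_continuous[OF analytic_torus_family_residual[OF u_fam]]
  define Z where "Z \<epsilon> \<psi> = of_real \<alpha> + \<epsilon> * profile u \<epsilon> \<psi>" for \<epsilon> \<psi>
  define X where "X \<gamma> \<psi> = Re (Z (of_real (1 / \<gamma>)) \<psi>)" for \<gamma> \<psi>
  define x0 where "x0 \<gamma> t = X \<gamma> (t *\<^sub>R \<omega>)" for \<gamma> t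
  \<comment> \<open>For real \<open>\<gamma> > 0\<close> the point \<open>1 / \<gamma>\<close> lies in the disc exactly when \<open>1 / \<gamma> < 2 R\<close>.\<close>
  define \<gamma>0 where "\<gamma>0 = 1 / (2 * R)"
  have "\<gamma>0 > 0"
    using \<open>R > 0\<close> by (simp add: \<gamma>0_def)
  have in_disc: "complex_of_real (1 / \<gamma>) \<in> ?D" if "\<gamma> > \<gamma>0" for \<gamma>
  proof -
    have "\<gamma> > 0"
      using that \<open>\<gamma>0 > 0\<close> by simp
    moreover have "1 / \<gamma> < 2 * R"
      using that \<open>R > 0\<close> \<open>\<gamma> > 0\<close> by (simp add: \<gamma>0_def field_simps)
    ultimately have "\<bar>R - 1 / \<gamma>\<bar> < R"
      by (simp add: abs_less_iff)
    then show ?thesis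
      unfolding tangent_disc_def mem_ball dist_norm of_real_diff[symmetric] norm_of_real .
  qed
  have Z_fam: "analytic_torus_family ?D Z"
    using P_fam unfolding analytic_torus_family_def Z_def case_prod_unfold
    by (auto simp: periodic_2pi_def intro!: continuous_intros holomorphic_intros)
  have prof_real: "profile u (of_real (1 / \<gamma>)) \<psi>
      = of_real (W (- 1) \<psi> + 1 / \<gamma> * w2 \<psi> + Re (u (of_real (1 / \<gamma>)) \<psi>))" if "\<gamma> > \<gamma>0" for \<gamma> \<psi>
  proof -
    have "u (of_real (1 / \<gamma>)) \<psi> \<in> \<real>"
      using u_real[unfolded real_on_reals_def, rule_format, OF in_disc[OF that] Reals_of_real] .
    then show ?thesis
      unfolding profile_def by (simp add: complex_eq_iff complex_is_Real_iff)
  qed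
  have Z_real: "Z (of_real (1 / \<gamma>)) \<psi> = of_real (X \<gamma> \<psi>)"
    and X_eq: "X \<gamma> \<psi> = \<alpha> + 1 / \<gamma> * (W (- 1) \<psi> + 1 / \<gamma> * w2 \<psi> + Re (u (of_real (1 / \<gamma>)) \<psi>))"
    if "\<gamma> > \<gamma>0" for \<gamma> \<psi>
    unfolding X_def Z_def prof_real[OF that] by (simp_all add: complex_eq_iff)
  have ode: "solves_ode p \<gamma> (\<lambda>t. f (t *\<^sub>R \<omega>)) (x0 \<gamma>)" if \<gamma>: "\<gamma> > \<gamma>0" for \<gamma>
  proof -
    define e where "e = 1 / \<gamma>"
    have "\<gamma> > 0"
      using that \<open>\<gamma>0 > 0\<close> by simp
    then have e\<gamma>: "\<gamma> * e = 1" and "e \<noteq> 0"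
      by (auto simp: e_def)
    note disc = in_disc[OF \<gamma>, folded e_def]
    obtain U' U'' where
      U': "\<And>t. ((\<lambda>t. u (of_real e) (t *\<^sub>R \<omega>)) has_vector_derivative U' t) (at t)" and
      U'': "\<And>t. (U' has_vector_derivative U'' t) (at t)" and
      eqU: "\<And>t. U'' t + 1 / of_real e * U' t = of_real e * residual u (of_real e) (t *\<^sub>R \<omega>)
        - (of_real a - (of_real a * of_real e)\<^sup>2) * u (of_real e) (t *\<^sub>R \<omega>)"
      by (rule oscillator_inverse_solves[OF \<open>a > 0\<close> R disc res_cont[OF disc] res_bound[OF disc],
            of \<omega>, unfolded fixed[OF disc]]) (rule that)
    \<comment> \<open>For real parameters the corrector is real; the real parts along the orbit of \<open>0\<close> give the
      real functions in which the equation is verified.\<close>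
    define v v' v'' where "v t = Re (u (of_real e) (t *\<^sub>R \<omega>))" and "v' t = Re (U' t)"
      and "v'' t = Re (U'' t)" for t
    have dv: "(v has_real_derivative v' t) (at t)" and dv': "(v' has_real_derivative v'' t) (at t)" for t
      using bounded_linear.has_vector_derivative[OF bounded_linear_Re U'[of t]]
        bounded_linear.has_vector_derivative[OF bounded_linear_Re U''[of t]]
      by (simp_all add: has_real_derivative_iff_has_vector_derivative v_def[abs_def] v'_def[abs_def] v''_def)
    define w where "w k t = W k (t *\<^sub>R \<omega>)" for k t
    have dw: "(w k has_real_derivative w (k + 1) t) (at t)" for k t
      using W_deriv[of k t] by (simp add: w_def[abs_def])
    define y where "y t = w (- 1) t + e * (- w 0 t - a * w (- 2) t) + v t" for t
    define q where "q t = Re (Q (of_real (e * y t)))" for t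
    have Qq: "Q (of_real (e * y t)) = of_real (q t)" for t
      using Q(2)[of "of_real (e * y t)"] by (simp add: q_def complex_eq_iff complex_is_Real_iff)
    have prof: "profile u (of_real e) (t *\<^sub>R \<omega>) = of_real (y t)" for t
      using prof_real[OF \<gamma>, of "t *\<^sub>R \<omega>", folded e_def] by (simp add: y_def v_def w_def w2_def)
    have u_v: "u (of_real e) (t *\<^sub>R \<omega>) = of_real (v t)" for t
      using u_real disc by (simp add: real_on_reals_def v_def complex_eq_iff complex_is_Real_iff)
    have res: "residual u (of_real e) (t *\<^sub>R \<omega>) = of_real
        ((w 2 t + 2 * a * w 0 t + a\<^sup>2 * w (- 2) t) - a\<^sup>2 * e * v t - (y t)\<^sup>2 * q t)" for t
      unfolding residual_def prof u_v of_real_mult[symmetric] Qq by (simp add: S_def w_def)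
    have v_eq: "v'' t + \<gamma> * v' t = e * ((w 2 t + 2 * a * w 0 t + a\<^sup>2 * w (- 2) t)
        - a\<^sup>2 * e * v t - (y t)\<^sup>2 * q t) - (a - (a * e)\<^sup>2) * v t" for t
    proof -
      have "Re (U'' t + of_real \<gamma> * U' t) = v'' t + \<gamma> * v' t"
        by (simp add: v'_def v''_def)
      moreover have "1 / complex_of_real e = of_real \<gamma>"
        by (simp add: e_def)
      ultimately show ?thesis
        using arg_cong[OF eqU[of t], of Re] unfolding res u_v
        by (simp only: of_real_mult[symmetric] of_real_power[symmetric] of_real_diff[symmetric] Re_complex_of_real)
    qed
    have x0_eq: "x0 \<gamma> = (\<lambda>t. \<alpha> + e * y t)"
      using X_eq[OF \<gamma>] by (simp add: x0_def[abs_def] e_def y_def v_def w_def w2_def)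
    define x' where "x' t = e * (w 0 t + e * (- w 1 t - a * w (- 1) t) + v' t)" for t
    define x'' where "x'' t = e * (w 1 t + e * (- w 2 t - a * w 0 t) + v'' t)" for t
    show ?thesis
      unfolding solves_ode_def
    proof (rule exI[of _ x'], rule exI[of _ x''], intro conjI allI)
      fix t
      show "(x0 \<gamma> has_real_derivative x' t) (at t)"
        unfolding x0_eq y_def x'_def
        using dw[of "- 1" t] dw[of 0 t] dw[of "- 2" t] dv[of t]
        by (auto intro!: derivative_eq_intros)
      show "(x' has_real_derivative x'' t) (at t)"
        unfolding x'_def[abs_def] x''_def
        using dw[of 0 t] dw[of 1 t] dw[of "- 1" t] dv'[of t]
        by (auto intro!: derivative_eq_intros)
      have "complex_of_real ((\<alpha> + e * y t) ^ (2 * p + 1))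
          = of_real (Re (c 0) + a * (e * y t) + (e * y t)\<^sup>2 * q t)"
        using Q(3)[of "of_real (e * y t)"] unfolding Qq \<alpha>_pow
        by (simp only: of_real_add[symmetric] of_real_mult[symmetric] of_real_power[symmetric])
      then have pw: "x0 \<gamma> t ^ (2 * p + 1) = Re (c 0) + a * (e * y t) + (e * y t)\<^sup>2 * q t"
        unfolding x0_eq of_real_eq_iff .
      have "x'' t + \<gamma> * x' t = e * (w 1 t + e * (- w 2 t - a * w 0 t))
          + (\<gamma> * e) * (w 0 t + e * (- w 1 t - a * w (- 1) t)) + e * (v'' t + \<gamma> * v' t)"
        by (simp add: x'_def x''_def algebra_simps)
      \<comment> \<open>The orders \<open>1\<close> and \<open>e\<close> cancel by the choice of \<open>w1\<close> and \<open>w2\<close>, the rest by the equation for \<open>v\<close>.\<close>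
      then show "x'' t + \<gamma> * x' t + x0 \<gamma> t ^ (2 * p + 1) = f (t *\<^sub>R \<omega>)"
        unfolding pw e\<gamma> v_eq f_eq y_def w_def[of 0, symmetric]
        by (simp add: algebra_simps power2_eq_square)
    qed
  qed
  have hull: "quasi_periodic_hull \<omega> (X \<gamma>) (x0 \<gamma>)" if "\<gamma> > \<gamma>0" for \<gamma>
  proof -
    have "continuous_on UNIV (X \<gamma>)"
      unfolding X_def[abs_def]
      by (intro continuous_intros analytic_torus_family_continuous[OF Z_fam in_disc[OF that]])
    moreover have "periodic_2pi (X \<gamma>)"
      using Z_fam in_disc[OF that] by (auto simp: X_def periodic_2pi_def analytic_torus_family_def)
    ultimately show ?thesis
      by (simp add: quasi_periodic_hull_def x0_def)
  qed
  have close: "\<bar>x0 \<gamma> t - \<alpha>\<bar> \<le> (2 * M + 1) / \<gamma>" if \<gamma>: "\<gamma> > \<gamma>0" for \<gamma> t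
  proof -
    let ?\<psi> = "t *\<^sub>R \<omega>"
    have "\<gamma> > 0"
      using that \<open>\<gamma>0 > 0\<close> by simp
    have "1 / \<gamma> < 2 * R"
      using tangent_disc_bounds(4)[OF in_disc[OF \<gamma>]] \<open>\<gamma> > 0\<close> by (simp add: norm_divide)
    then have "1 / \<gamma> \<le> 1"
      using \<open>R \<le> 1 / 2\<close> by linarith
    then have "1 / \<gamma> * \<bar>w2 ?\<psi>\<bar> \<le> 1 * M"
      using bounds(2) \<open>\<gamma> > 0\<close> by (intro mult_mono) auto
    then have "\<bar>1 / \<gamma> * w2 ?\<psi>\<bar> \<le> M"
      using \<open>\<gamma> > 0\<close> by (simp add: abs_mult)
    moreover have "\<bar>Re (u (of_real (1 / \<gamma>)) ?\<psi>)\<bar> \<le> 1"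
      using order.trans[OF abs_Re_le_cmod u_le[OF in_disc[OF \<gamma>]]] .
    ultimately have "\<bar>W (- 1) ?\<psi> + 1 / \<gamma> * w2 ?\<psi> + Re (u (of_real (1 / \<gamma>)) ?\<psi>)\<bar> \<le> 2 * M + 1"
      using bounds(1)[of ?\<psi>] by linarith
    from mult_left_mono[OF this, of "1 / \<gamma>"] show ?thesis
      unfolding x0_def X_eq[OF \<gamma>] using \<open>\<gamma> > 0\<close> by (simp add: abs_mult)
  qed
  have "\<forall>\<gamma> > \<gamma>0. solves_ode p \<gamma> (\<lambda>t. f (t *\<^sub>R \<omega>)) (x0 \<gamma>) \<and> quasi_periodic_hull \<omega> (X \<gamma>) (x0 \<gamma>)"
    using ode hull by simp
  moreover have "\<exists>R > 0. \<exists>Z. analytic_torus_family (tangent_disc R) Z \<and>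
      (\<forall>\<gamma> > \<gamma>0. complex_of_real (1 / \<gamma>) \<in> tangent_disc R \<and>
        (\<forall>\<psi>. Z (complex_of_real (1 / \<gamma>)) \<psi> = complex_of_real (X \<gamma> \<psi>)))"
    by (intro exI[of _ R] exI[of _ Z] conjI allI impI \<open>R > 0\<close> Z_fam in_disc Z_real)
  moreover have "\<exists>K. \<forall>\<gamma> > \<gamma>0. \<forall>t. \<bar>x0 \<gamma> t - \<alpha>\<bar> \<le> K / \<gamma>"
    by (intro exI[of _ "2 * M + 1"] allI impI close)
  ultimately show ?thesis
    unfolding \<alpha>_def[symmetric] using \<open>\<gamma>0 > 0\<close> \<open>\<alpha> \<noteq> 0\<close>
    by - (rule exI[of _ \<gamma>0], rule conjI, assumption, rule exI[of _ x0], rule exI[of _ X], intro conjI)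
qed

end
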